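(* Let $G=(V,E)$ be an infinite, connected graph of bounded degree, and let $\{G^{(r)}=(U^{(r)},E^{(r)})\}_{r\in\mathbb{N}}$ be a family of finite connected subgraphs of $G$ such that $\operatorname{dist}_G(U^{(i)},U^{(j)})\geq 3$ for all $i\neq j$. Let $\mathbb{G}$ be the ladder graph over $G$, let $\mathbb{P}_{q,p}$ be the associated inhomogeneous Bernoulli bond percolation measure, and let $p_c(q)$ be its critical curve (all defined in the context). If $\sup_{r\in\mathbb{N}}|U^{(r)}|<\infty$, then the function $q\mapsto p_c(q)$ is continuous on $(0,1)$.
   Context: $\operatorname{dist}_G(\cdot,\cdot)$ denotes the graph distance in $G$, between vertices or sets of vertices. Ladder graph: $\mathbb{G}=(\mathbb{V},\mathbb{E})$ has vertex set $\mathbb{V}:=V\times\mathbb{Z}$ and edge set $$\mathbb{E}:=\{\langle(u,n),(v,n)\rangle:\langle u,v\rangle\in E,\ n\in\mathbb{Z}\}\cup\{\langle(w,n),(w,n+1)\rangle: w\in V,\ n\in\mathbb{Z}\}.$$ For each $r\in\mathbb{N}$ let $$\mathbb{E}^{\mathrm{in},(r)}:=\{\langle(u,n),(v,n)\rangle:\langle u,v\rangle\in E^{(r)},\ n\in\mathbb{Z}\}\cup\{\langle(w,n),(w,n+1)\rangle: w\in U^{(r)},\ n\in\mathbb{Z}\}.$$ Percolation measure: for $p\in[0,1]$ and $q\in(0,1)$, $\mathbb{P}_{q,p}$ is the product probability measure on $\Omega=\{0,1\}^{\mathbb{E}}$ (with the $\sigma$-algebra generated by finite-dimensional cylinders; $1$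 = open, $0$ = closed) under which edges are independent, each edge of $\bigcup_{r\in\mathbb{N}}\mathbb{E}^{\mathrm{in},(r)}$ is open with probability $q$, and each edge of $\mathbb{E}\setminus\bigcup_{r\in\mathbb{N}}\mathbb{E}^{\mathrm{in},(r)}$ is open with probability $p$. The cluster of a vertex $x\in\mathbb{V}$ is the set of vertices that are equal to $x$ or joined to $x$ by a path of open edges; $\{x\leftrightarrow\infty\}$ is the event that the cluster of $x$ is infinite. Critical curve: for a fixed $v\in V$, $$p_c(q):=\sup\{p\in[0,1]:\mathbb{P}_{q,p}((v,0)\leftrightarrow\infty)=0\};$$ since $\mathbb{G}$ is connected, this value does not depend on the choice of $v$. *)

theory Defs
  imports "HOL-Probability.Probability" "HOL-Library.Extended_Nat"
begin

text \<open>A graph is a vertex set together with a set of edges, an edge being an unordered pair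
  of distinct vertices. Paths are nonempty vertex lists; repetitions are allowed, which changes
  neither distances nor connectivity, and \<open>[x]\<close> is the path of length 0 from \<open>x\<close> to itself.\<close>

definition simple_graph :: "'a set \<Rightarrow> 'a set set \<Rightarrow> bool" where
  "simple_graph V E \<longleftrightarrow> (\<forall>e\<in>E. \<exists>u\<in>V. \<exists>v\<in>V. u \<noteq> v \<and> e = {u, v})"

definition subgraph_of :: "'a set \<Rightarrow> 'a set set \<Rightarrow> 'a set \<Rightarrow> 'a set set \<Rightarrow> bool" where
  "subgraph_of U F V E \<longleftrightarrow> simple_graph U F \<and> U \<subseteq> V \<and> F \<subseteq> E"

definition graph_path :: "'a set \<Rightarrow> 'a set set \<Rightarrow> 'a \<Rightarrow> 'a list \<Rightarrow> 'a \<Rightarrow> bool" where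
  "graph_path V E x xs y \<longleftrightarrow> xs \<noteq> [] \<and> hd xs = x \<and> last xs = y \<and> set xs \<subseteq> V \<and>
     successively (\<lambda>u v. {u, v} \<in> E) xs"

definition connected_graph :: "'a set \<Rightarrow> 'a set set \<Rightarrow> bool" where
  "connected_graph V E \<longleftrightarrow> V \<noteq> {} \<and> (\<forall>x\<in>V. \<forall>y\<in>V. \<exists>xs. graph_path V E x xs y)"

definition bounded_degree :: "'a set \<Rightarrow> 'a set set \<Rightarrow> bool" where
  "bounded_degree V E \<longleftrightarrow>
     (\<exists>D. \<forall>v\<in>V. finite {e\<in>E. v \<in> e} \<and> card {e\<in>E. v \<in> e} \<le> D)"

definition graph_dist :: "'a set \<Rightarrow> 'a set set \<Rightarrow> 'a \<Rightarrow> 'a \<Rightarrow> enat" where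
  "graph_dist V E x y = (INF xs \<in> {xs. graph_path V E x xs y}. enat (length xs - 1))"

definition graph_setdist :: "'a set \<Rightarrow> 'a set set \<Rightarrow> 'a set \<Rightarrow> 'a set \<Rightarrow> enat" where
  "graph_setdist V E A B = (INF x\<in>A. INF y\<in>B. graph_dist V E x y)"

definition ladder_vertices :: "'a set \<Rightarrow> ('a \<times> int) set" where
  "ladder_vertices V = V \<times> UNIV"

text \<open>With \<open>(U r, F r)\<close> in place of \<open>(V, E)\<close>, the same formula gives the inner edges
  of the ladder over the subgraph \<open>(U r, F r)\<close>.\<close>

definition ladder_edges :: "'a set \<Rightarrow> 'a set set \<Rightarrow> ('a \<times> int) set set" where
  "ladder_edges V E =
     {{(u, n), (v, n)} | u v n. {u, v} \<in> E} \<union> {{(w, n), (w, n + 1)} | w n. w \<in> V}"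

definition inner_edges :: "(nat \<Rightarrow> 'a set) \<Rightarrow> (nat \<Rightarrow> 'a set set) \<Rightarrow> ('a \<times> int) set set" where
  "inner_edges U F = (\<Union>r. ladder_edges (U r) (F r))"

text \<open>In a configuration, \<open>True\<close> means open. The components of the product carry the discrete
  \<open>\<sigma>\<close>-algebra on \<open>bool\<close>, so the product \<open>\<sigma>\<close>-algebra is generated by the cylinders.\<close>

definition perc_measure ::
  "'a set \<Rightarrow> 'a set set \<Rightarrow> (nat \<Rightarrow> 'a set) \<Rightarrow> (nat \<Rightarrow> 'a set set) \<Rightarrow> real \<Rightarrow> real
     \<Rightarrow> (('a \<times> int) set \<Rightarrow> bool) measure" where
  "perc_measure V E U F q p =
     (\<Pi>\<^sub>M e\<in>ladder_edges V E.
        measure_pmf (bernoulli_pmf (if e \<in> inner_edges U F then q else p)))"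

definition cluster ::
  "'a set \<Rightarrow> 'a set set \<Rightarrow> (('a \<times> int) set \<Rightarrow> bool) \<Rightarrow> 'a \<times> int \<Rightarrow> ('a \<times> int) set" where
  "cluster V E \<omega> x =
     {y. \<exists>xs. graph_path (ladder_vertices V) {e \<in> ladder_edges V E. \<omega> e} x xs y}"

text \<open>For a connected graph of bounded degree the ladder has countably many edges, so the event
  that a cluster is infinite is measurable and its \<open>measure\<close> is its actual probability.\<close>

definition perc_prob ::
  "'a set \<Rightarrow> 'a set set \<Rightarrow> (nat \<Rightarrow> 'a set) \<Rightarrow> (nat \<Rightarrow> 'a set set) \<Rightarrow> 'a \<times> int \<Rightarrow> real \<Rightarrow> real
     \<Rightarrow> real" where
  "perc_prob V E U F x q p =
     measure (perc_measure V E U F q p)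
       {\<omega> \<in> space (perc_measure V E U F q p). infinite (cluster V E \<omega> x)}"

definition critical_curve ::
  "'a set \<Rightarrow> 'a set set \<Rightarrow> (nat \<Rightarrow> 'a set) \<Rightarrow> (nat \<Rightarrow> 'a set set) \<Rightarrow> 'a \<Rightarrow> real \<Rightarrow> real" where
  "critical_curve V E U F v q = Sup {p \<in> {0..1}. perc_prob V E U F (v, 0) q p = 0}"

end

(* Russo's formula and a local modification argument bound the effect of raising q by that of
   raising p. Pick a vertex w r outside U r adjacent to U r and cut the strips into the finite blocks
   (U r + w r) x {2m, 2m+1}; since the U r are at distance at least 3, these blocks are disjoint. If an
   inner edge is pivotal for the connection from the origin to the complement of a large finite box,
   the configuration near one block can be rewired so that an outer edge of that block, such as
   <(w r, 2m), (w r, 2m+1)>, becomes pivotal. As block sizes are bounded, the cost of rewiring is a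
   constant C that is uniform for q and p away from 0 and 1, hence the q-derivative of the connection
   probability is at most C times its p-derivative. So lowering q by d is compensated by raising p
   by C d, in the limit of large boxes also for percolation, and p_c is continuous. The origin's own
   block is treated as a single source, at the price of a finite-energy factor; the supremum
   defining p_c is not over the empty set because at p = 0 clusters live in one strip. *)
theory Submission
  imports Defs
begin

section \<open>Bernoulli expectations on finite sets\<close>

text \<open>Resampling a block helps only if an outer edge ends up as the sole link between two
  fixed sides: the part reached from the source and the part joined to the exterior, both taken with
  all edges at the block closed. If one of the edges by which these parts enter the block is outer,
  that edge serves. The hard case is that both are inner. Each is then a rung over a vertex of
  \<open>U r\<close>, the two entry points differ, and the strip over \<open>U r\<close> itself may
  contain no outer edge. Hence the extra vertex \<open>w0 r\<close>, whose rung is outer, and hence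
  blocks of height two: entry points at different heights are linked through that rung, and entry
  points in one layer by walking to \<open>w0 r\<close>, crossing, and returning through the other
  layer. The scheme breaks down at the origin's block, where one side would start inside the
  resampled region; this is why that block becomes the source. Derivatives are taken only in finite
  boxes, where probabilities are polynomials in the weights, and no constant depends on the box. As
  p_c sees only where the percolation probability vanishes, a positive factor lost on the way is
  harmless.\<close>

text \<open>Configurations on a finite edge set are encoded as the set \<open>H\<close> of open
  edges, so that expectations are finite sums accessible to induction over the edges.\<close>

definition expec :: "'e set \<Rightarrow> ('e \<Rightarrow> real) \<Rightarrow> ('e set \<Rightarrow> real) \<Rightarrow> real" where
  "expec S x f = (\<Sum>H\<in>Pow S. (\<Prod>e\<in>S. if e \<in> H then x e else 1 - x e) * f H)"

lemma expec_empty [simp]: "expec {} x f = f {}"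
  by (simp add: expec_def)

text \<open>Independence over disjoint edge sets, as Fubini for finite sums; conditioning on the
  edges outside a block goes through it.\<close>

lemma expec_union:
  assumes "finite A" "finite B" "A \<inter> B = {}"
  shows "expec (A \<union> B) x f = expec A x (\<lambda>G. expec B x (\<lambda>H. f (G \<union> H)))"
proof -
  let ?w = "\<lambda>S H. \<Prod>e\<in>S. if e \<in> H then x e else 1 - x e"
  have bij: "bij_betw (\<lambda>(G, H). G \<union> H) (Pow A \<times> Pow B) (Pow (A \<union> B))"
  proof (rule bij_betw_byWitness[where f' = "\<lambda>H. (H \<inter> A, H \<inter> B)"])
  qed (use assms in auto)
  have w: "?w (A \<union> B) (G \<union> H) = ?w A G * ?w B H" if "G \<subseteq> A" "H \<subseteq> B" for G H
  proof -
    have "?w (A \<union> B) (G \<union> H) = ?w A (G \<union> H) * ?w B (G \<union> H)"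
      using assms by (intro prod.union_disjoint) auto
    also have "?w A (G \<union> H) = ?w A G" using that assms by (intro prod.cong) auto
    also have "?w B (G \<union> H) = ?w B H" using that assms by (intro prod.cong) auto
    finally show ?thesis .
  qed
  have "expec (A \<union> B) x f = (\<Sum>(G, H)\<in>Pow A \<times> Pow B. ?w (A \<union> B) (G \<union> H) * f (G \<union> H))"
    unfolding expec_def by (subst sum.reindex_bij_betw[OF bij, symmetric]) (simp add: case_prod_beta)
  also have "\<dots> = (\<Sum>(G, H)\<in>Pow A \<times> Pow B. ?w A G * (?w B H * f (G \<union> H)))"
  proof (intro sum.cong refl, clarify)
    fix G H assume "G \<subseteq> A" "H \<subseteq> B"
    then show "?w (A \<union> B) (G \<union> H) * f (G \<union> H) = ?w A G * (?w B H * f (G \<union> H))"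
      by (simp only: w mult.assoc)
  qed
  also have "\<dots> = expec A x (\<lambda>G. expec B x (\<lambda>H. f (G \<union> H)))"
    unfolding expec_def by (simp add: sum.cartesian_product[symmetric] sum_distrib_left)
  finally show ?thesis .
qed

lemma expec_insert:
  assumes "finite S" "a \<notin> S"
  shows "expec (insert a S) x f =
    x a * expec S x (\<lambda>H. f (insert a H)) + (1 - x a) * expec S x f"
proof -
  have "expec (insert a S) x f = expec ({a} \<union> S) x f" by simp
  also have "\<dots> = expec {a} x (\<lambda>G. expec S x (\<lambda>H. f (G \<union> H)))"
    using assms by (intro expec_union) auto
  also have "\<dots> = x a * expec S x (\<lambda>H. f (insert a H)) + (1 - x a) * expec S x f"
    by (simp add: expec_def Pow_insert)
  finally show ?thesis .
qed

lemma expec_cong: "(\<And>H. H \<subseteq> S \<Longrightarrow> f H = g H) \<Longrightarrow> expec S x f = expec S x g"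
  unfolding expec_def by (intro sum.cong) auto

lemma expec_cong_weight: "(\<And>e. e \<in> S \<Longrightarrow> x e = y e) \<Longrightarrow> expec S x f = expec S y f"
  unfolding expec_def by (intro sum.cong arg_cong2[where f="(*)"] prod.cong) auto

lemma expec_diff: "expec S x (\<lambda>H. f H - g H) = expec S x f - expec S x g"
  unfolding expec_def by (simp add: right_diff_distrib sum_subtractf)

lemma expec_sum: "expec S x (\<lambda>H. \<Sum>i\<in>I. f i H) = (\<Sum>i\<in>I. expec S x (f i))"
  unfolding expec_def by (simp add: sum_distrib_left sum.swap[of _ I])

lemma expec_cmult: "expec S x (\<lambda>H. c * f H) = c * expec S x f"
  unfolding expec_def by (simp add: sum_distrib_left algebra_simps)

lemma expec_mono:
  assumes "\<And>e. e \<in> S \<Longrightarrow> 0 \<le> x e \<and> x e \<le> 1" "\<And>H. H \<subseteq> S \<Longrightarrow> f H \<le> g H"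
  shows "expec S x f \<le> expec S x g"
  unfolding expec_def using assms by (intro sum_mono mult_left_mono prod_nonneg) auto

lemma expec_nonneg:
  assumes "\<And>e. e \<in> S \<Longrightarrow> 0 \<le> x e \<and> x e \<le> 1" "\<And>H. H \<subseteq> S \<Longrightarrow> 0 \<le> f H"
  shows "0 \<le> expec S x f"
  unfolding expec_def using assms by (intro sum_nonneg mult_nonneg_nonneg prod_nonneg) auto

lemma expec_const: "finite S \<Longrightarrow> expec S x (\<lambda>_. c) = c"
  by (induction S rule: finite_induct) (simp_all add: expec_insert algebra_simps)

lemma expec_null: "finite S \<Longrightarrow> (\<And>e. e \<in> S \<Longrightarrow> x e = 0) \<Longrightarrow> expec S x f = f {}"
  by (induction S arbitrary: f rule: finite_induct) (simp_all add: expec_insert)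

lemma expec_superset:
  assumes "finite T" "S \<subseteq> T" "\<And>H. H \<subseteq> T \<Longrightarrow> f H = f (H \<inter> S)"
  shows "expec T x f = expec S x f"
proof -
  have fin: "finite S" using assms finite_subset by auto
  have "expec T x f = expec (S \<union> (T - S)) x f" using assms by (simp add: Un_absorb1)
  also have "\<dots> = expec S x (\<lambda>G. expec (T - S) x (\<lambda>H. f (G \<union> H)))"
    using assms fin by (intro expec_union) auto
  also have "\<dots> = expec S x (\<lambda>G. expec (T - S) x (\<lambda>H. f G))"
  proof (intro expec_cong)
    fix G H assume "G \<subseteq> S" "H \<subseteq> T - S"
    then have "G \<union> H \<subseteq> T" "(G \<union> H) \<inter> S = G" using assms(2) by auto
    then show "f (G \<union> H) = f G" using assms(3)[of "G \<union> H"] by simp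
  qed
  also have "\<dots> = expec S x f" using assms by (simp add: expec_const)
  finally show ?thesis .
qed

text \<open>The expectation is affine in the weight of a single edge \<open>a\<close>, with slope
  the expected gain from opening \<open>a\<close>, nonnegative for monotone \<open>f\<close>.
  Raising the weights one by one replaces a coupling.\<close>

lemma expec_mono_weight:
  assumes "finite S" "\<And>e. e \<in> S \<Longrightarrow> 0 \<le> x e \<and> x e \<le> y e \<and> y e \<le> 1" "mono f"
  shows "expec S x f \<le> expec S y f"
  using assms
proof (induction S arbitrary: f rule: finite_induct)
  case empty
  then show ?case by simp
next
  case (insert a S)
  have m: "mono (\<lambda>H. f (insert a H))"
    using insert.prems(2) by (auto intro!: monoI elim!: monoD)
  have i: "expec S x f \<le> expec S y f" "expec S x (\<lambda>H. f (insert a H)) \<le> expec S y (\<lambda>H. f (insert a H))"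
    using insert m by auto
  have le: "expec S y f \<le> expec S y (\<lambda>H. f (insert a H))"
    using insert.prems by (intro expec_mono) (force intro: monoD[OF insert.prems(2)])+
  have a: "0 \<le> x a" "x a \<le> y a" "y a \<le> 1" using insert.prems by auto
  have "expec (insert a S) x f \<le> x a * expec S y (\<lambda>H. f (insert a H)) + (1 - x a) * expec S y f"
    unfolding expec_insert[OF insert.hyps(1,2)] using a i by (intro add_mono mult_left_mono) auto
  also have "\<dots> = expec S y f + x a * (expec S y (\<lambda>H. f (insert a H)) - expec S y f)"
    by (simp add: algebra_simps)
  also have "\<dots> \<le> expec S y f + y a * (expec S y (\<lambda>H. f (insert a H)) - expec S y f)"
    using a le by (intro add_mono mult_right_mono) auto
  also have "\<dots> = expec (insert a S) y f"
    unfolding expec_insert[OF insert.hyps(1,2)] by (simp add: algebra_simps)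
  finally show ?case .
qed

section \<open>Russo's formula and finite energy\<close>

text \<open>Chain rule along a curve of weights: the expectation is affine in each weight, with
  slope the expected discrete difference of \<open>f\<close> at that edge. Monotonicity enters only
  later, when the difference becomes the indicator of pivotality.\<close>

lemma russo_formula:
  fixes x :: "real \<Rightarrow> 'e \<Rightarrow> real"
  assumes "finite S" "\<And>e. e \<in> S \<Longrightarrow> ((\<lambda>t. x t e) has_real_derivative x' e) (at t)"
  shows "((\<lambda>t. expec S (x t) f) has_real_derivative
      (\<Sum>e\<in>S. x' e * expec S (x t) (\<lambda>H. f (insert e H) - f (H - {e})))) (at t)"
  using assms
proof (induction S arbitrary: f rule: finite_induct)
  case empty
  then show ?case by simp
next
  case (insert a S)
  let ?d = "\<lambda>e f H. f (insert e H) - f (H - {e})"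
  define g where "g = (\<lambda>H. f (insert a H))"
  define Df where "Df = (\<Sum>e\<in>S. x' e * expec S (x t) (?d e f))"
  define Dg where "Dg = (\<Sum>e\<in>S. x' e * expec S (x t) (?d e g))"
  have D: "((\<lambda>t. expec S (x t) f) has_real_derivative Df) (at t)"
    "((\<lambda>t. expec S (x t) g) has_real_derivative Dg) (at t)"
    "((\<lambda>t. x t a) has_real_derivative x' a) (at t)"
    unfolding Df_def Dg_def using insert by auto
  have "((\<lambda>t. x t a * expec S (x t) g + (1 - x t a) * expec S (x t) f) has_real_derivative
      x' a * (expec S (x t) g - expec S (x t) f) + (x t a * Dg + (1 - x t a) * Df)) (at t)"
    by (rule derivative_eq_intros D refl | simp add: algebra_simps)+
  moreover have "x' a * (expec S (x t) g - expec S (x t) f) + (x t a * Dg + (1 - x t a) * Df) =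
    (\<Sum>e\<in>insert a S. x' e * expec (insert a S) (x t) (?d e f))"
  proof -
    \<comment> \<open>The difference at \<open>a\<close> does not see the state of \<open>a\<close>,
      so the open and the closed half of the split over \<open>a\<close> coincide.\<close>
    have 1: "expec (insert a S) (x t) (?d a f) = expec S (x t) g - expec S (x t) f"
    proof -
      have "expec S (x t) (\<lambda>H. ?d a f (insert a H)) = expec S (x t) (\<lambda>H. g H - f H)"
        "expec S (x t) (?d a f) = expec S (x t) (\<lambda>H. g H - f H)"
        using insert.hyps(2) by (auto intro!: expec_cong simp: g_def)
          (metis Diff_empty Diff_insert0 subsetD insert_Diff_single Diff_insert_absorb)+
      then show ?thesis
        unfolding expec_insert[OF insert.hyps(1,2)] by (simp add: expec_diff algebra_simps)
    qed
    have 2: "expec (insert a S) (x t) (?d e f) =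
        x t a * expec S (x t) (?d e g) + (1 - x t a) * expec S (x t) (?d e f)" if "e \<in> S" for e
    proof -
      have "insert e (insert a H) = insert a (insert e H)" "insert a H - {e} = insert a (H - {e})" for H
        using that insert.hyps(2) by auto
      then show ?thesis unfolding expec_insert[OF insert.hyps(1,2)] g_def by simp
    qed
    have "(\<Sum>e\<in>S. x' e * expec (insert a S) (x t) (?d e f)) = x t a * Dg + (1 - x t a) * Df"
      unfolding Dg_def Df_def sum_distrib_left sum.distrib[symmetric]
      by (intro sum.cong refl) (simp add: 2 algebra_simps)
    then show ?thesis using insert.hyps 1 by simp
  qed
  ultimately show ?case
    unfolding expec_insert[OF insert.hyps(1,2)] g_def by simp
qed

text \<open>Finite energy: fix the configuration outside \<open>B\<close>. If \<open>P\<close> is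
  possible at all, some pattern \<open>H'\<close> on \<open>B\<close> yields \<open>Q\<close>, and
  every single pattern has conditional probability at least \<open>c ^ card B\<close>, while that of
  \<open>P\<close> is at most 1. One pattern per outside configuration suffices, so no preimages are
  counted.\<close>

lemma expec_local_modification:
  assumes "finite S" "B \<subseteq> S" "c \<ge> 0"
    and x: "\<And>e. e \<in> S \<Longrightarrow> 0 \<le> x e \<and> x e \<le> 1"
    and xc: "\<And>e. e \<in> B \<Longrightarrow> c \<le> x e \<and> c \<le> 1 - x e"
    and mod: "\<And>H. H \<subseteq> S \<Longrightarrow> P H \<Longrightarrow> \<exists>H'\<subseteq>B. Q ((H - B) \<union> H')"
  shows "c ^ card B * expec S x (\<lambda>H. of_bool (P H)) \<le> expec S x (\<lambda>H. of_bool (Q H))"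
proof -
  have fin: "finite B" using assms(2,1) by (rule finite_subset)
  have split: "expec S x f = expec (S - B) x (\<lambda>G. expec B x (\<lambda>H. f (G \<union> H)))" for f
  proof -
    have "(S - B) \<union> B = S" using assms(2) by auto
    then show ?thesis using expec_union[of "S - B" B x f] assms(1) fin by auto
  qed
  have key: "c ^ card B * expec B x (\<lambda>H. of_bool (P (G \<union> H))) \<le> expec B x (\<lambda>H. of_bool (Q (G \<union> H)))"
    if G: "G \<subseteq> S - B" for G
  proof (cases "\<exists>H\<subseteq>B. P (G \<union> H)")
    case True
    then obtain H where H: "H \<subseteq> B" "P (G \<union> H)" by auto
    then have "G \<union> H \<subseteq> S" "(G \<union> H) - B = G" using G assms by auto
    then obtain H' where H': "H' \<subseteq> B" "Q (G \<union> H')" using mod[of "G \<union> H"] H by auto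
    have "expec B x (\<lambda>H. of_bool (P (G \<union> H))) \<le> expec B x (\<lambda>H. 1)"
      using x assms by (intro expec_mono) auto
    then have "c ^ card B * expec B x (\<lambda>H. of_bool (P (G \<union> H))) \<le> c ^ card B"
      using fin assms by (simp add: expec_const mult_left_le)
    also have "\<dots> = (\<Prod>e\<in>B. c)" by simp
    also have "\<dots> \<le> (\<Prod>e\<in>B. if e \<in> H' then x e else 1 - x e)"
      using xc assms(3) by (intro prod_mono) auto
    also have "\<dots> = (\<Prod>e\<in>B. if e \<in> H' then x e else 1 - x e) * of_bool (Q (G \<union> H'))"
      using H' by simp
    also have "\<dots> \<le> expec B x (\<lambda>H. of_bool (Q (G \<union> H)))"
      unfolding expec_def using H' fin x assms
      by (intro member_le_sum mult_nonneg_nonneg prod_nonneg) auto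
    finally show ?thesis .
  next
    case False
    then have "expec B x (\<lambda>H. of_bool (P (G \<union> H))) = expec B x (\<lambda>H. 0)"
      by (intro expec_cong) auto
    then show ?thesis using fin x assms by (auto simp: expec_const intro!: expec_nonneg)
  qed
  have "c ^ card B * expec S x (\<lambda>H. of_bool (P H)) =
      expec (S - B) x (\<lambda>G. c ^ card B * expec B x (\<lambda>H. of_bool (P (G \<union> H))))"
    by (simp add: split expec_cmult)
  also have "\<dots> \<le> expec S x (\<lambda>H. of_bool (Q H))"
    unfolding split using x key by (intro expec_mono) auto
  finally show ?thesis .
qed

text \<open>An event determined by the finite set \<open>S\<close> is a disjoint union of cylinders,
  one for each pattern on \<open>S\<close>, and a cylinder has the product weight. This is the only
  passage between finite sums and the infinite product measure.\<close>

lemma measure_PiM_bernoulli_eq_expec: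
  fixes Ed :: "'e set" and x :: "'e \<Rightarrow> real"
  assumes "finite S" "S \<subseteq> Ed" "\<And>H. H \<subseteq> Ed \<Longrightarrow> P H \<longleftrightarrow> P (H \<inter> S)"
    and x: "\<And>e. e \<in> Ed \<Longrightarrow> 0 \<le> x e \<and> x e \<le> 1"
  defines "M \<equiv> PiM Ed (\<lambda>e. measure_pmf (bernoulli_pmf (x e)))"
  shows "{\<omega> \<in> space M. P {e\<in>Ed. \<omega> e}} \<in> sets M"
    and "measure M {\<omega> \<in> space M. P {e\<in>Ed. \<omega> e}} = expec S x (\<lambda>H. of_bool (P H))"
proof -
  interpret product_prob_space "\<lambda>e. measure_pmf (bernoulli_pmf (x e))" Ed
    by unfold_locales
  define Cyl where "Cyl H = {\<omega> \<in> space M. \<forall>e\<in>S. \<omega> e \<in> {e \<in> H}}" for H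
  have fin: "finite {H \<in> Pow S. P H}" using assms by auto
  have sets: "Cyl H \<in> sets M" for H
    unfolding Cyl_def M_def using assms(1,2)
    by (intro sets.sets_Collect_finite_All sets_Collect_single) auto
  have P: "P {e\<in>Ed. \<omega> e} \<longleftrightarrow> P {e\<in>S. \<omega> e}" for \<omega>
  proof -
    have "{e\<in>Ed. \<omega> e} \<inter> S = {e\<in>S. \<omega> e}" using assms by auto
    then show ?thesis using assms(3)[of "{e\<in>Ed. \<omega> e}"] by auto
  qed
  have eq: "{\<omega> \<in> space M. P {e\<in>Ed. \<omega> e}} = (\<Union>H\<in>{H \<in> Pow S. P H}. Cyl H)"
  proof (intro equalityI subsetI)
    fix \<omega> assume "\<omega> \<in> {\<omega> \<in> space M. P {e\<in>Ed. \<omega> e}}"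
    then have "\<omega> \<in> Cyl {e\<in>S. \<omega> e}" "{e\<in>S. \<omega> e} \<in> {H \<in> Pow S. P H}"
      by (auto simp: Cyl_def P)
    then show "\<omega> \<in> (\<Union>H\<in>{H \<in> Pow S. P H}. Cyl H)" by blast
  next
    fix \<omega> assume "\<omega> \<in> (\<Union>H\<in>{H \<in> Pow S. P H}. Cyl H)"
    then obtain H where H: "H \<subseteq> S" "P H" "\<omega> \<in> Cyl H" by auto
    then have "{e\<in>S. \<omega> e} = H" by (auto simp: Cyl_def)
    then show "\<omega> \<in> {\<omega> \<in> space M. P {e\<in>Ed. \<omega> e}}" using H P by (auto simp: Cyl_def)
  qed
  show "{\<omega> \<in> space M. P {e\<in>Ed. \<omega> e}} \<in> sets M"
    unfolding eq using sets fin by (intro sets.finite_UN) auto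
  have "disjoint_family_on Cyl {H \<in> Pow S. P H}"
    by (auto simp: disjoint_family_on_def Cyl_def)
  then have "measure M (\<Union>H\<in>{H \<in> Pow S. P H}. Cyl H) = (\<Sum>H\<in>{H \<in> Pow S. P H}. measure M (Cyl H))"
    unfolding M_def using fin sets by (intro finite_measure_finite_Union) (auto simp: M_def)
  also have "\<dots> = (\<Sum>H\<in>{H \<in> Pow S. P H}. (\<Prod>e\<in>S. if e \<in> H then x e else 1 - x e))"
  proof (intro sum.cong refl)
    fix H
    have "Cyl H = prod_emb Ed (\<lambda>e. measure_pmf (bernoulli_pmf (x e))) S (\<Pi>\<^sub>E e\<in>S. {e \<in> H})"
      unfolding prod_emb_def Cyl_def M_def using assms(2) by (auto simp: space_PiM PiE_iff extensional_def)
    then have "measure M (Cyl H) = (\<Prod>e\<in>S. measure (measure_pmf (bernoulli_pmf (x e))) {e \<in> H})"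
      unfolding M_def using assms(1,2) by (simp add: measure_PiM_emb)
    also have "\<dots> = (\<Prod>e\<in>S. if e \<in> H then x e else 1 - x e)"
      using x assms(2) by (intro prod.cong refl) (auto simp: measure_pmf_single)
    finally show "measure M (Cyl H) = (\<Prod>e\<in>S. if e \<in> H then x e else 1 - x e)" .
  qed
  also have "\<dots> = expec S x (\<lambda>H. of_bool (P H))"
    unfolding expec_def using assms(1)
    by (intro sum.mono_neutral_cong_left) auto
  finally show "measure M {\<omega> \<in> space M. P {e\<in>Ed. \<omega> e}} = expec S x (\<lambda>H. of_bool (P H))"
    unfolding eq .
qed

section \<open>Pivotal edges in graphs divided into blocks\<close>

definition adj :: "'b set set \<Rightarrow> ('b \<times> 'b) set" where
  "adj H = {(a, b). {a, b} \<in> H}"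

lemma adj_mono: "H \<subseteq> H' \<Longrightarrow> adj H \<subseteq> adj H'"
  by (auto simp: adj_def)

lemma sym_adj: "sym (adj H)"
  by (auto simp: adj_def sym_def insert_commute)

lemma adj_rtrancl_sym: "(a, b) \<in> (adj H)\<^sup>* \<Longrightarrow> (b, a) \<in> (adj H)\<^sup>*"
  by (meson sym_adj sym_rtrancl symD)

lemma adj_rtrancl_mono: "(a, b) \<in> (adj H)\<^sup>* \<Longrightarrow> H \<subseteq> H' \<Longrightarrow> (a, b) \<in> (adj H')\<^sup>*"
  using rtrancl_mono[OF adj_mono] by blast

lemma adj_edge: "{a, b} \<in> H \<Longrightarrow> (a, b) \<in> (adj H)\<^sup>*"
  by (auto simp: adj_def)

lemma rtrancl_closed:
  assumes "(a, b) \<in> R\<^sup>*" "a \<in> C" "\<And>x y. x \<in> C \<Longrightarrow> (x, y) \<in> R \<Longrightarrow> y \<in> C"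
  shows "b \<in> C"
  using assms(1,2) by induction (auto intro: assms(3))

lemma rtrancl_exit:
  assumes "(a, b) \<in> R\<^sup>*" "a \<in> C" "b \<notin> C"
  obtains x y where "(x, y) \<in> R" "x \<in> C" "y \<notin> C"
  using assms rtrancl_closed by metis

text \<open>Finite-volume substitute for an infinite cluster: \<open>K\<close> is the source, and
  leaving the finite set \<open>L\<close> counts as escaping.\<close>

definition reach :: "'b set set \<Rightarrow> 'b set \<Rightarrow> 'b set \<Rightarrow> bool" where
  "reach H K L \<longleftrightarrow> (\<exists>k\<in>K. \<exists>z. z \<notin> L \<and> (k, z) \<in> (adj H)\<^sup>*)"

lemma reach_mono: "reach H K L \<Longrightarrow> H \<subseteq> H' \<Longrightarrow> reach H' K L"
  unfolding reach_def by (meson adj_rtrancl_mono)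

text \<open>A path may be cut at its first exit from \<open>L\<close>, and all edges up to there
  meet \<open>L\<close>. In a locally finite graph this makes \<open>reach\<close> depend on
  finitely many edges.\<close>

lemma reach_inter:
  assumes "K \<subseteq> L" "\<And>e. e \<in> H \<Longrightarrow> e \<inter> L \<noteq> {} \<Longrightarrow> e \<in> S"
  shows "reach H K L \<longleftrightarrow> reach (H \<inter> S) K L"
proof
  assume "reach H K L"
  then obtain k z where k: "k \<in> K" "z \<notin> L" "(k, z) \<in> (adj H)\<^sup>*" by (auto simp: reach_def)
  let ?R = "{y. (k, y) \<in> (adj (H \<inter> S))\<^sup>*}"
  show "reach (H \<inter> S) K L"
  proof (rule ccontr)
    assume n: "\<not> reach (H \<inter> S) K L"
    then have R: "?R \<subseteq> L" using k by (auto simp: reach_def)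
    then have "z \<notin> ?R" using k by auto
    then obtain x y where xy: "(x, y) \<in> adj H" "x \<in> ?R" "y \<notin> ?R"
      using rtrancl_exit[OF k(3), of ?R] by auto
    then have "{x, y} \<in> H \<inter> S" using R assms(2)[of "{x, y}"] by (auto simp: adj_def)
    then have "y \<in> ?R" using xy(2) by (auto intro: rtrancl_into_rtrancl simp: adj_def)
    then show False using xy by auto
  qed
next
  assume "reach (H \<inter> S) K L"
  then show "reach H K L" by (rule reach_mono) auto
qed

text \<open>For increasing \<open>A\<close> the indicator of this event is the discrete difference
  in \<open>russo_formula\<close>; it ignores the state of \<open>e\<close>.\<close>

definition pivotal :: "('e set \<Rightarrow> bool) \<Rightarrow> 'e \<Rightarrow> 'e set \<Rightarrow> bool" where
  "pivotal A e H \<longleftrightarrow> A (insert e H) \<and> \<not> A (H - {e})"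

definition touching :: "'b set set \<Rightarrow> 'b set \<Rightarrow> 'b set set" where
  "touching Ed W = {e \<in> Ed. e \<inter> W \<noteq> {}}"

lemma touching_mono: "W \<subseteq> W' \<Longrightarrow> touching Ed W \<subseteq> touching Ed W'"
  by (auto simp: touching_def)

text \<open>The assumption \<open>rewire\<close> says that two edges entering the block of an inner edge from different
  vertices \<open>x'\<close> and \<open>y'\<close> can be linked by edges \<open>\<eta>\<close> and an outer bridge \<open>f\<close>; \<open>C\<close> is the side of
  \<open>x'\<close> when \<open>f\<close> is closed.\<close>

locale blocked_graph =
  fixes X :: "'b set" and Ed inn :: "'b set set" and blk :: "'b \<Rightarrow> 'b set" and o0 :: 'b
    and D \<kappa> :: nat
  assumes edge: "e \<in> Ed \<Longrightarrow> \<exists>a\<in>X. \<exists>b\<in>X. a \<noteq> b \<and> e = {a, b}"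
    and o0: "o0 \<in> X"
    and connected: "x \<in> X \<Longrightarrow> (o0, x) \<in> (adj Ed)\<^sup>*"
    and degree: "x \<in> X \<Longrightarrow> finite {e \<in> Ed. x \<in> e} \<and> card {e \<in> Ed. x \<in> e} \<le> D"
    and inn: "inn \<subseteq> Ed"
    and blk_self: "x \<in> X \<Longrightarrow> x \<in> blk x"
    and blk_sub: "x \<in> X \<Longrightarrow> blk x \<subseteq> X"
    and blk_eq: "x \<in> X \<Longrightarrow> y \<in> blk x \<Longrightarrow> blk y = blk x"
    and blk_finite: "x \<in> X \<Longrightarrow> finite (blk x)"
    and blk_card: "x \<in> X \<Longrightarrow> card (blk x) \<le> \<kappa>"
    and blk_connected: "x \<in> X \<Longrightarrow> y \<in> blk x \<Longrightarrow> (x, y) \<in> (adj {e \<in> Ed. e \<subseteq> blk x})\<^sup>*"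
    and rewire: "\<lbrakk>e \<in> inn; z \<in> e; {x', x} \<in> Ed; {y, y'} \<in> Ed; x \<in> blk z; y \<in> blk z;
       x' \<notin> blk z; y' \<notin> blk z; x' \<noteq> y'\<rbrakk> \<Longrightarrow>
       \<exists>\<eta> f C. f \<in> touching Ed (blk z) - inn \<and> f \<notin> \<eta> \<and> \<eta> \<subseteq> touching Ed (blk z) \<and>
         (\<forall>e\<in>\<eta>. e \<subseteq> blk z \<union> {x', y'}) \<and>
         (x', y') \<in> (adj (insert f \<eta>))\<^sup>* \<and> x' \<in> C \<and> y' \<notin> C \<and> C \<subseteq> insert x' (blk z) \<and>
         (\<forall>a b. {a, b} \<in> \<eta> \<longrightarrow> a \<in> C \<longrightarrow> b \<in> C)"
begin

lemma finite_touching: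
  assumes "finite W" "W \<subseteq> X"
  shows "finite (touching Ed W)"
proof -
  have "touching Ed W = (\<Union>x\<in>W. {e \<in> Ed. x \<in> e})" by (auto simp: touching_def)
  then show ?thesis using assms degree by auto
qed

lemma card_touching:
  assumes "finite W" "W \<subseteq> X"
  shows "card (touching Ed W) \<le> card W * D"
proof -
  have "touching Ed W = (\<Union>x\<in>W. {e \<in> Ed. x \<in> e})" by (auto simp: touching_def)
  then have "card (touching Ed W) \<le> (\<Sum>x\<in>W. card {e \<in> Ed. x \<in> e})"
    using assms by (simp add: card_UN_le)
  also have "\<dots> \<le> (\<Sum>x\<in>W. D)" using assms degree by (intro sum_mono) auto
  finally show ?thesis by simp
qed

abbreviation K :: "'b set" where "K \<equiv> blk o0"

text \<open>Being a union of blocks keeps every resampled edge among those touching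
  \<open>L\<close>. The last clause excludes edges from \<open>K\<close> straight to the exterior,
  which could be pivotal without any other block of \<open>L\<close> to rewire.\<close>

definition saturated :: "'b set \<Rightarrow> bool" where
  "saturated L \<longleftrightarrow> finite L \<and> L \<subseteq> X \<and> (\<forall>x\<in>L. blk x \<subseteq> L) \<and> K \<subseteq> L \<and>
     (\<forall>e\<in>touching Ed K. e \<subseteq> L)"

lemma blk_sym: "x \<in> X \<Longrightarrow> y \<in> blk x \<Longrightarrow> x \<in> blk y"
  using blk_eq[of x y] blk_self[of x] by simp

text \<open>All edges meeting the block \<open>W\<close> are resampled. In what remains open, let \<open>R0\<close> be the set
  reached from \<open>K\<close> and \<open>R1\<close> the set joined to the outside of \<open>L\<close>: a pivotal edge at \<open>W\<close> forces both
  to have a neighbour in \<open>W\<close>, and \<open>rewire\<close> joins them through an outer edge.\<close>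

lemma pivotal_outer_edge:
  assumes L: "saturated L" and e: "e \<in> inn" "z \<in> e" "z \<in> L" "z \<notin> K"
    and H: "H \<subseteq> Ed" and p: "pivotal (\<lambda>H. reach H K L) e H"
  defines "B \<equiv> touching Ed (blk z)"
  shows "\<exists>H'\<subseteq>B. \<exists>f\<in>B - inn. pivotal (\<lambda>H. reach H K L) f ((H - B) \<union> H')"
proof -
  let ?W = "blk z"
  have zX: "z \<in> X" using e L by (auto simp: saturated_def)
  have WL: "?W \<subseteq> L" using e L by (auto simp: saturated_def)
  have WK: "?W \<inter> K = {}"
  proof (rule ccontr)
    assume "?W \<inter> K \<noteq> {}"
    then obtain y where y: "y \<in> ?W" "y \<in> K" by auto
    then have "blk z = K" using blk_eq[OF zX y(1)] blk_eq[OF o0 y(2)] by simp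
    then show False using e blk_self[OF zX] by auto
  qed
  have zW: "z \<in> ?W" using blk_self[OF zX] .
  have eB: "e \<in> B" using e zW inn by (auto simp: B_def touching_def)
  define G where "G = H - B"
  define R0 where "R0 = {y. \<exists>k\<in>K. (k, y) \<in> (adj G)\<^sup>*}"
  define R1 where "R1 = {y. \<exists>w. w \<notin> L \<and> (y, w) \<in> (adj G)\<^sup>*}"
  have KR0: "K \<subseteq> R0" by (auto simp: R0_def)
  have LR1: "- L \<subseteq> R1" by (auto simp: R1_def)
  have GW: "{a, b} \<in> G \<Longrightarrow> a \<notin> ?W \<and> b \<notin> ?W" for a b
    using H by (auto simp: G_def B_def touching_def)
  have R0s: "a \<in> R0 \<Longrightarrow> {a, b} \<in> G \<Longrightarrow> b \<in> R0" for a b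
    unfolding R0_def by (auto intro: rtrancl_into_rtrancl simp: adj_def)
  have R1s: "b \<in> R1 \<Longrightarrow> {a, b} \<in> G \<Longrightarrow> a \<in> R1" for a b
    unfolding R1_def by (auto intro: converse_rtrancl_into_rtrancl simp: adj_def)
  have R0W: "R0 \<inter> ?W = {}"
  proof -
    have "y \<notin> ?W" if "k \<in> K" "(k, y) \<in> (adj G)\<^sup>*" for k y
      using that(2) by cases (use that WK GW in \<open>auto simp: adj_def\<close>)
    then show ?thesis by (auto simp: R0_def)
  qed
  have R1W: "R1 \<inter> ?W = {}"
  proof -
    have "y \<notin> ?W" if "w \<notin> L" "(y, w) \<in> (adj G)\<^sup>*" for w y
      using that(2) by (cases rule: converse_rtranclE) (use that WL GW in \<open>auto simp: adj_def\<close>)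
    then show ?thesis by (auto simp: R1_def)
  qed
  have "\<not> reach G K L"
    using p reach_mono[of G K L "H - {e}"] eB by (auto simp: pivotal_def G_def)
  \<comment> \<open>A common vertex would give an exit through edges of \<open>G\<close> alone,
    hence one with \<open>e\<close> closed.\<close>
  then have R01: "R0 \<inter> R1 = {}"
    unfolding R0_def R1_def reach_def by (blast intro: rtrancl_trans)
  have "reach (G \<union> B) K L"
    using p reach_mono[of "insert e H" K L "G \<union> B"] eB by (auto simp: pivotal_def G_def)
  then obtain k w where kw: "k \<in> K" "w \<notin> L" "(k, w) \<in> (adj (G \<union> B))\<^sup>*"
    by (auto simp: reach_def)
  have "w \<notin> R0" using kw LR1 R01 by auto
  \<comment> \<open>The path must leave \<open>R0\<close> and, below, enter \<open>R1\<close>. Both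
    sets are closed under \<open>G\<close>, so it does so by edges of \<open>B\<close>, whose other
    ends lie in the block.\<close>
  then obtain x' x where x: "(x', x) \<in> adj (G \<union> B)" "x' \<in> R0" "x \<notin> R0"
    using rtrancl_exit[OF kw(3)] KR0 kw(1) by blast
  have "k \<notin> R1" using kw KR0 R01 by auto
  then obtain y y' where y: "(y, y') \<in> adj (G \<union> B)" "y \<notin> R1" "y' \<in> R1"
    using rtrancl_exit[OF kw(3), of "- R1"] LR1 kw(2) by blast
  have xB: "{x', x} \<in> B" using x R0s by (auto simp: adj_def)
  have yB: "{y, y'} \<in> B" using y R1s by (auto simp: adj_def)
  have x'W: "x' \<notin> ?W" "y' \<notin> ?W" using x y R0W R1W by auto
  have xW: "x \<in> ?W" "y \<in> ?W" using xB yB x'W by (auto simp: B_def touching_def)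
  have xE: "{x', x} \<in> Ed" and yE: "{y, y'} \<in> Ed" using xB yB by (auto simp: B_def touching_def)
  have "x' \<noteq> y'" using x y R01 by auto
  obtain \<eta> f C where r: "f \<in> B - inn" "f \<notin> \<eta>" "\<eta> \<subseteq> B" "\<forall>e\<in>\<eta>. e \<subseteq> ?W \<union> {x', y'}"
    "(x', y') \<in> (adj (insert f \<eta>))\<^sup>*" "x' \<in> C" "y' \<notin> C" "C \<subseteq> insert x' ?W"
    "\<forall>a b. {a, b} \<in> \<eta> \<longrightarrow> a \<in> C \<longrightarrow> b \<in> C"
    using rewire[OF e(1,2) xE yE xW x'W \<open>x' \<noteq> y'\<close>] 
    unfolding B_def[symmetric] by (elim exE conjE) (rule that; assumption)
  have "reach (insert f (G \<union> \<eta>)) K L"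
  proof -
    obtain k where k: "k \<in> K" "(k, x') \<in> (adj G)\<^sup>*" using x by (auto simp: R0_def)
    obtain w where w: "w \<notin> L" "(y', w) \<in> (adj G)\<^sup>*" using y by (auto simp: R1_def)
    let ?A = "adj (insert f (G \<union> \<eta>))"
    have "(k, x') \<in> ?A\<^sup>*" "(x', y') \<in> ?A\<^sup>*" "(y', w) \<in> ?A\<^sup>*"
      using k(2) w(2) r(5) by - (erule adj_rtrancl_mono, blast)+
    then show ?thesis using k w unfolding reach_def by (meson rtrancl_trans)
  qed
  moreover have "\<not> reach (G \<union> \<eta>) K L"
  proof
    assume "reach (G \<union> \<eta>) K L"
    then obtain k w where kw: "k \<in> K" "w \<notin> L" "(k, w) \<in> (adj (G \<union> \<eta>))\<^sup>*"
      by (auto simp: reach_def)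
    \<comment> \<open>\<open>R0 \<union> C\<close> is closed under all open edges: edges of
      \<open>G\<close> avoid the block, so within \<open>C\<close> they can start only at
      \<open>x'\<close>, and edges of \<open>\<eta>\<close> meet \<open>R0\<close> only in
      \<open>x'\<close>.\<close>
    have "w \<in> R0 \<union> C"
    proof (rule rtrancl_closed[OF kw(3)])
      fix a b assume ab: "a \<in> R0 \<union> C" "(a, b) \<in> adj (G \<union> \<eta>)"
      show "b \<in> R0 \<union> C"
      proof (cases "{a, b} \<in> G")
        case True
        then have "a \<notin> ?W" using GW by auto
        then have "a \<in> R0" using ab r(8) x by auto
        then show ?thesis using True R0s by auto
      next
        case False
        then have e: "{a, b} \<in> \<eta>" using ab by (auto simp: adj_def)
        then have "a \<in> ?W \<union> {x', y'}" using r(4) by auto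
        then have "a \<in> C" using ab r(6) R0W R01 y by auto
        then show ?thesis using e r(9) by auto
      qed
    qed (use kw KR0 in auto)
    moreover have "w \<notin> R0" using kw(2) LR1 R01 by auto
    moreover have "w \<notin> C" using kw(2) r(8) WL x(2) R01 LR1 by auto
    ultimately show False by auto
  qed
  moreover have "(G \<union> \<eta>) - {f} = G \<union> \<eta>" using r by (auto simp: G_def)
  ultimately have "pivotal (\<lambda>H. reach H K L) f (G \<union> \<eta>)" by (simp add: pivotal_def)
  then show ?thesis using r(1,3) unfolding G_def by blast
qed

text \<open>An edge inside \<open>K\<close> joins two sources, and an edge missing \<open>L\<close>
  has no influence. Hence every pivotal edge has an end in a block other than the origin's, where
  the rewiring applies.\<close>

lemma pivotal_endpoint:
  assumes L: "saturated L" and e: "e \<in> Ed" and p: "pivotal (\<lambda>H. reach H K L) e H"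
  shows "\<exists>z\<in>e. z \<in> L \<and> z \<notin> K"
proof (rule ccontr)
  assume n: "\<not> ?thesis"
  obtain a b where ab: "e = {a, b}" "a \<noteq> b" using edge[OF e] by auto
  have "e \<subseteq> K \<or> e \<inter> L = {}"
  proof (cases "e \<inter> K = {}")
    case True
    then show ?thesis using n by auto
  next
    case False
    then have "e \<subseteq> L" using L e by (auto simp: saturated_def touching_def)
    then show ?thesis using n by auto
  qed
  then show False
  proof
    assume eK: "e \<subseteq> K"
    have *: "y \<in> {y. \<exists>k\<in>K. (k, y) \<in> (adj (H - {e}))\<^sup>*}"
      if "k \<in> K" "(k, y) \<in> (adj (insert e H))\<^sup>*" for k y
      using that(2)
    proof (rule rtrancl_closed)
      fix s t assume st: "s \<in> {y. \<exists>k\<in>K. (k, y) \<in> (adj (H - {e}))\<^sup>*}" "(s, t) \<in> adj (insert e H)"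
      show "t \<in> {y. \<exists>k\<in>K. (k, y) \<in> (adj (H - {e}))\<^sup>*}"
      proof (cases "{s, t} = e")
        case True
        then have "t \<in> K" using eK by auto
        then show ?thesis by auto
      next
        case False
        then have "(s, t) \<in> adj (H - {e})" using st by (auto simp: adj_def)
        then show ?thesis using st by (auto intro: rtrancl_into_rtrancl)
      qed
    qed (use that in auto)
    obtain k w where "k \<in> K" "w \<notin> L" "(k, w) \<in> (adj (insert e H))\<^sup>*"
      using p by (auto simp: pivotal_def reach_def)
    with *[of k w] have "reach (H - {e}) K L" by (auto simp: reach_def)
    then show False using p by (simp add: pivotal_def)
  next
    assume eL: "e \<inter> L = {}"
    have "reach (insert e H) K L \<longleftrightarrow> reach (insert e H \<inter> (H - {e})) K L"
      using L eL by (intro reach_inter) (auto simp: saturated_def)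
    moreover have "insert e H \<inter> (H - {e}) = H - {e}" by auto
    ultimately show False using p by (simp add: pivotal_def)
  qed
qed

lemma finite_touching_saturated: "saturated L \<Longrightarrow> finite (touching Ed L)"
  by (auto simp: saturated_def finite_touching)

section \<open>Comparing exit probabilities in finite volume\<close>

definition weight :: "real \<Rightarrow> real \<Rightarrow> 'b set \<Rightarrow> real" where
  "weight q p e = (if e \<in> inn then q else p)"

text \<open>The differential inequality is proved for this source \<open>K\<close>;
  \<open>exit_prob\<close>, with source \<open>o0\<close>, is the quantity that converges to the
  percolation probability.\<close>

definition block_exit_prob :: "'b set \<Rightarrow> real \<Rightarrow> real \<Rightarrow> real" where
  "block_exit_prob L q p = expec (touching Ed L) (weight q p) (\<lambda>H. of_bool (reach H K L))"

definition exit_prob :: "'b set \<Rightarrow> real \<Rightarrow> real \<Rightarrow> real" where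
  "exit_prob L q p = expec (touching Ed L) (weight q p) (\<lambda>H. of_bool (reach H {o0} L))"

definition pivotal_prob :: "'b set \<Rightarrow> real \<Rightarrow> real \<Rightarrow> 'b set \<Rightarrow> real" where
  "pivotal_prob L q p e = expec (touching Ed L) (weight q p) (\<lambda>H. of_bool (pivotal (\<lambda>H. reach H K L) e H))"

lemma pivotal_prob_nonneg: "0 \<le> q \<Longrightarrow> q \<le> 1 \<Longrightarrow> 0 \<le> p \<Longrightarrow> p \<le> 1 \<Longrightarrow> 0 \<le> pivotal_prob L q p e"
  unfolding pivotal_prob_def by (intro expec_nonneg) (auto simp: weight_def)

text \<open>Finite energy applied to the rewiring at the block of \<open>z\<close>: at most
  \<open>\<kappa>\<close> vertices of degree at most \<open>D\<close> give at most
  \<open>\<kappa> * D\<close> resampled edges. The sum on the right is a union bound over the outer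
  edges that may have become pivotal.\<close>

lemma pivotal_prob_inner_le:
  assumes L: "saturated L" and e: "e \<in> inn" "z \<in> e" "z \<in> L" "z \<notin> K"
    and c: "0 < c" "c \<le> q" "q \<le> 1 - c" "c \<le> p" "p \<le> 1 - c"
  shows "c ^ (\<kappa> * D) * pivotal_prob L q p e \<le> (\<Sum>f\<in>touching Ed (blk z) - inn. pivotal_prob L q p f)"
proof -
  let ?B = "touching Ed (blk z)" and ?S = "touching Ed L"
  have zX: "z \<in> X" "blk z \<subseteq> L" using e L by (auto simp: saturated_def)
  have fB: "finite ?B" using blk_finite blk_sub zX by (intro finite_touching) auto
  have "card ?B \<le> card (blk z) * D" using blk_finite blk_sub zX by (intro card_touching) auto
  also have "\<dots> \<le> \<kappa> * D" using blk_card zX by auto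
  finally have cB: "c ^ (\<kappa> * D) \<le> c ^ card ?B" using c by (intro power_decreasing) auto
  have wb: "0 \<le> weight q p e \<and> weight q p e \<le> 1" "c \<le> weight q p e \<and> c \<le> 1 - weight q p e" for e
    using c by (auto simp: weight_def)
  have "c ^ (\<kappa> * D) * pivotal_prob L q p e \<le> c ^ card ?B * pivotal_prob L q p e"
    using cB c by (intro mult_right_mono pivotal_prob_nonneg) auto
  also have "\<dots> \<le> expec ?S (weight q p) (\<lambda>H. of_bool (\<exists>f\<in>?B - inn. pivotal (\<lambda>H. reach H K L) f H))"
    unfolding pivotal_prob_def
  proof (rule expec_local_modification)
    show "?B \<subseteq> ?S" using zX by (intro touching_mono)
    fix H assume "H \<subseteq> ?S" "pivotal (\<lambda>H. reach H K L) e H"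
    moreover from this have "H \<subseteq> Ed" by (auto simp: touching_def)
    ultimately show "\<exists>H'\<subseteq>?B. \<exists>f\<in>?B - inn. pivotal (\<lambda>H. reach H K L) f ((H - ?B) \<union> H')"
      using pivotal_outer_edge[OF L e] by blast
  qed (use L finite_touching_saturated wb c in auto)
  also have "\<dots> \<le> expec ?S (weight q p) (\<lambda>H. \<Sum>f\<in>?B - inn. of_bool (pivotal (\<lambda>H. reach H K L) f H))"
  proof (rule expec_mono)
    fix H
    show "of_bool (\<exists>f\<in>?B - inn. pivotal (\<lambda>H. reach H K L) f H) \<le>
      (\<Sum>f\<in>?B - inn. of_bool (pivotal (\<lambda>H. reach H K L) f H) :: real)"
    proof (cases "\<exists>f\<in>?B - inn. pivotal (\<lambda>H. reach H K L) f H")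
      case True
      then obtain f where f: "f \<in> ?B - inn" "pivotal (\<lambda>H. reach H K L) f H" by auto
      have "of_bool (pivotal (\<lambda>H. reach H K L) f H) \<le>
        (\<Sum>f\<in>?B - inn. of_bool (pivotal (\<lambda>H. reach H K L) f H) :: real)"
        using fB f by (intro member_le_sum) auto
      then show ?thesis using f True by simp
    qed (auto intro: sum_nonneg)
  qed (use wb in auto)
  also have "\<dots> = (\<Sum>f\<in>?B - inn. pivotal_prob L q p f)" by (simp add: expec_sum pivotal_prob_def)
  finally show ?thesis .
qed

text \<open>Double counting: each inner edge that can be pivotal is charged to the outer edges at
  one block it meets. An outer edge has two ends, hence meets at most two blocks, and each block is
  touched by at most \<open>\<kappa> * D\<close> edges.\<close>

lemma sum_inner_le_sum_outer:
  assumes L: "saturated L"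
    and c: "0 < c" "c \<le> q" "q \<le> 1 - c" "c \<le> p" "p \<le> 1 - c"
  shows "c ^ (\<kappa> * D) * (\<Sum>e\<in>touching Ed L \<inter> inn. pivotal_prob L q p e)
    \<le> real (2 * (\<kappa> * D)) * (\<Sum>f\<in>touching Ed L - inn. pivotal_prob L q p f)"
proof -
  let ?S = "touching Ed L"
  define I where "I = {e \<in> ?S \<inter> inn. \<exists>z\<in>e. z \<in> L \<and> z \<notin> K}"
  define g where "g e = (SOME z. z \<in> e \<and> z \<in> L \<and> z \<notin> K)" for e
  have g: "g e \<in> e \<and> g e \<in> L \<and> g e \<notin> K" if "e \<in> I" for e
    unfolding g_def using that by (intro someI_ex[of "\<lambda>z. z \<in> e \<and> z \<in> L \<and> z \<notin> K"]) (simp add: I_def Bex_def)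
  have fS: "finite ?S" using L by (rule finite_touching_saturated)
  have fI: "finite I" using fS by (auto simp: I_def)
  have gX: "g e \<in> X" "blk (g e) \<subseteq> L" if "e \<in> I" for e
    using g[OF that] L by (auto simp: saturated_def)
  have pn: "0 \<le> pivotal_prob L q p e" for e using c by (intro pivotal_prob_nonneg) auto
  have z: "pivotal_prob L q p e = 0" if "e \<in> ?S \<inter> inn - I" for e
  proof -
    have "\<not> pivotal (\<lambda>H. reach H K L) e H" for H
      using that pivotal_endpoint[OF L, of e H] by (auto simp: I_def touching_def)
    then show ?thesis using fS by (simp add: pivotal_prob_def expec_const)
  qed
  have "c ^ (\<kappa> * D) * (\<Sum>e\<in>?S \<inter> inn. pivotal_prob L q p e) = (\<Sum>e\<in>I. c ^ (\<kappa> * D) * pivotal_prob L q p e)"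
    unfolding sum_distrib_left using fS z by (intro sum.mono_neutral_right) (auto simp: I_def)
  also have "\<dots> \<le> (\<Sum>e\<in>I. \<Sum>f\<in>touching Ed (blk (g e)) - inn. pivotal_prob L q p f)"
    using g c L by (intro sum_mono pivotal_prob_inner_le) (auto simp: I_def)
  also have "\<dots> = (\<Sum>e\<in>I. \<Sum>f | f \<in> ?S - inn \<and> f \<inter> blk (g e) \<noteq> {}. pivotal_prob L q p f)"
    using gX by (intro sum.cong refl) (auto simp: touching_def)
  also have "\<dots> = (\<Sum>e\<in>I. \<Sum>f\<in>?S - inn. if f \<inter> blk (g e) \<noteq> {} then pivotal_prob L q p f else 0)"
    using fS by (intro sum.cong refl sum.inter_filter) auto
  also have "\<dots> = (\<Sum>f\<in>?S - inn. \<Sum>e\<in>I. if f \<inter> blk (g e) \<noteq> {} then pivotal_prob L q p f else 0)"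
    by (rule sum.swap)
  also have "\<dots> = (\<Sum>f\<in>?S - inn. real (card {e \<in> I. f \<inter> blk (g e) \<noteq> {}}) * pivotal_prob L q p f)"
    using fI by (intro sum.cong refl) (simp add: sum.inter_filter[symmetric])
  also have "\<dots> \<le> (\<Sum>f\<in>?S - inn. real (2 * (\<kappa> * D)) * pivotal_prob L q p f)"
  proof (intro sum_mono mult_right_mono pn)
    fix f assume "f \<in> ?S - inn"
    then obtain a b where f: "a \<in> X" "b \<in> X" "f = {a, b}" using edge[of f] by (auto simp: touching_def)
    have "{e \<in> I. f \<inter> blk (g e) \<noteq> {}} \<subseteq> touching Ed (blk a) \<union> touching Ed (blk b)"
    proof
      fix e assume "e \<in> {e \<in> I. f \<inter> blk (g e) \<noteq> {}}"
      then have e: "e \<in> I" "a \<in> blk (g e) \<or> b \<in> blk (g e)" using f by auto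
      then have "g e \<in> blk a \<or> g e \<in> blk b" using blk_sym gX by blast
      then show "e \<in> touching Ed (blk a) \<union> touching Ed (blk b)"
        using g[OF e(1)] e(1) by (auto simp: I_def touching_def)
    qed
    moreover have fin: "finite (touching Ed (blk a))" "finite (touching Ed (blk b))"
      using f blk_finite blk_sub by (auto intro: finite_touching)
    ultimately have "card {e \<in> I. f \<inter> blk (g e) \<noteq> {}} \<le> card (touching Ed (blk a) \<union> touching Ed (blk b))"
      by (intro card_mono) auto
    also have "\<dots> \<le> card (touching Ed (blk a)) + card (touching Ed (blk b))" by (rule card_Un_le)
    also have "\<dots> \<le> card (blk a) * D + card (blk b) * D"
      using f blk_finite blk_sub by (intro add_mono card_touching) auto
    also have "\<dots> \<le> \<kappa> * D + \<kappa> * D" using f blk_card by (intro add_mono mult_right_mono) auto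
    finally have "card {e \<in> I. f \<inter> blk (g e) \<noteq> {}} \<le> 2 * (\<kappa> * D)" by simp
    then show "real (card {e \<in> I. f \<inter> blk (g e) \<noteq> {}}) \<le> real (2 * (\<kappa> * D))" by (rule of_nat_mono)
  qed
  also have "\<dots> = real (2 * (\<kappa> * D)) * (\<Sum>f\<in>?S - inn. pivotal_prob L q p f)"
    by (simp add: sum_distrib_left)
  finally show ?thesis .
qed

text \<open>On the segment from \<open>(q2, p1)\<close> to \<open>(q1, p2)\<close> the derivative is
  \<open>(p2 - p1) * PO - (q2 - q1) * PI\<close>, with \<open>PI\<close> and \<open>PO\<close> the
  total inner and outer pivotal probabilities. The factor in \<open>M\<close> is the multiple of
  \<open>PO\<close> that bounds \<open>PI\<close>.\<close>

lemma block_exit_prob_compare: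
  assumes L: "saturated L" and c: "0 < c"
    and q: "c \<le> q1" "q1 \<le> q2" "q2 \<le> 1 - c" and p: "c \<le> p1" "p1 \<le> p2" "p2 \<le> 1 - c"
    and M: "real (2 * (\<kappa> * D)) / c ^ (\<kappa> * D) * (q2 - q1) \<le> p2 - p1"
  shows "block_exit_prob L q2 p1 \<le> block_exit_prob L q1 p2"
proof -
  define Q where "Q t = q2 - t * (q2 - q1)" for t
  define R where "R t = p1 + t * (p2 - p1)" for t
  define x where "x t = weight (Q t) (R t)" for t
  define x' where "x' = weight (- (q2 - q1)) (p2 - p1)"
  let ?S = "touching Ed L"
  let ?A = "\<lambda>H. reach H K L"
  have fS: "finite ?S" using L by (rule finite_touching_saturated)
  have "block_exit_prob L (Q 0) (R 0) \<le> block_exit_prob L (Q 1) (R 1)"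
  proof (rule DERIV_nonneg_imp_nondecreasing[of 0 1 "\<lambda>t. block_exit_prob L (Q t) (R t)"])
    fix t :: real assume t: "0 \<le> t" "t \<le> 1"
    have Qb: "c \<le> Q t" "Q t \<le> 1 - c"
    proof -
      have "t * (q2 - q1) \<le> q2 - q1" "0 \<le> t * (q2 - q1)" using t q by (auto intro: mult_left_le_one_le)
      then show "c \<le> Q t" "Q t \<le> 1 - c" using q by (auto simp: Q_def)
    qed
    have Rb: "c \<le> R t" "R t \<le> 1 - c"
    proof -
      have "t * (p2 - p1) \<le> p2 - p1" "0 \<le> t * (p2 - p1)" using t p by (auto intro: mult_left_le_one_le)
      then show "c \<le> R t" "R t \<le> 1 - c" using p by (auto simp: R_def)
    qed
    define PI where "PI = (\<Sum>e\<in>?S \<inter> inn. pivotal_prob L (Q t) (R t) e)"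
    define PO where "PO = (\<Sum>e\<in>?S - inn. pivotal_prob L (Q t) (R t) e)"
    have cm: "c ^ (\<kappa> * D) * PI \<le> real (2 * (\<kappa> * D)) * PO"
      unfolding PI_def PO_def using Qb Rb c L by (intro sum_inner_le_sum_outer) auto
    have dx: "((\<lambda>t. x t e) has_real_derivative x' e) (at t)" for e
      unfolding x_def x'_def weight_def Q_def R_def
      by (cases "e \<in> inn") (auto intro!: derivative_eq_intros)
    have "((\<lambda>t. block_exit_prob L (Q t) (R t)) has_real_derivative
      (\<Sum>e\<in>?S. x' e * expec ?S (x t) (\<lambda>H. of_bool (?A (insert e H)) - of_bool (?A (H - {e}))))) (at t)"
      unfolding block_exit_prob_def x_def[symmetric] by (rule russo_formula[OF fS dx])
    moreover have "(\<Sum>e\<in>?S. x' e * expec ?S (x t) (\<lambda>H. of_bool (?A (insert e H)) - of_bool (?A (H - {e}))))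
      = (p2 - p1) * PO - (q2 - q1) * PI"
    proof -
      have "of_bool (?A (insert e H)) - of_bool (?A (H - {e})) = (of_bool (pivotal ?A e H) :: real)" for e H
        using reach_mono[of "H - {e}" K L "insert e H"] by (auto simp: pivotal_def)
      then have "(\<Sum>e\<in>?S. x' e * expec ?S (x t) (\<lambda>H. of_bool (?A (insert e H)) - of_bool (?A (H - {e}))))
        = (\<Sum>e\<in>?S. x' e * pivotal_prob L (Q t) (R t) e)"
        by (simp add: pivotal_prob_def x_def)
      also have "\<dots> = (\<Sum>e\<in>?S \<inter> inn. x' e * pivotal_prob L (Q t) (R t) e) + (\<Sum>e\<in>?S - inn. x' e * pivotal_prob L (Q t) (R t) e)"
        using fS by (rule sum.Int_Diff)
      also have "(\<Sum>e\<in>?S \<inter> inn. x' e * pivotal_prob L (Q t) (R t) e) = - (q2 - q1) * PI"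
        unfolding PI_def sum_distrib_left by (intro sum.cong refl) (auto simp: x'_def weight_def)
      also have "(\<Sum>e\<in>?S - inn. x' e * pivotal_prob L (Q t) (R t) e) = (p2 - p1) * PO"
        unfolding PO_def sum_distrib_left by (intro sum.cong refl) (auto simp: x'_def weight_def)
      finally show ?thesis by (simp add: algebra_simps)
    qed
    moreover have "0 \<le> (p2 - p1) * PO - (q2 - q1) * PI"
    proof -
      have "0 \<le> PO" unfolding PO_def using Qb Rb c by (intro sum_nonneg pivotal_prob_nonneg) auto
      have "PI \<le> real (2 * (\<kappa> * D)) / c ^ (\<kappa> * D) * PO"
        using cm c by (simp add: field_simps)
      then have "(q2 - q1) * PI \<le> (q2 - q1) * (real (2 * (\<kappa> * D)) / c ^ (\<kappa> * D) * PO)"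
        using q by (intro mult_left_mono) auto
      also have "\<dots> = (real (2 * (\<kappa> * D)) / c ^ (\<kappa> * D) * (q2 - q1)) * PO" by simp
      also have "\<dots> \<le> (p2 - p1) * PO" using M \<open>0 \<le> PO\<close> by (rule mult_right_mono)
      finally show ?thesis by simp
    qed
    ultimately show "\<exists>y. ((\<lambda>t. block_exit_prob L (Q t) (R t)) has_real_derivative y) (at t) \<and> 0 \<le> y" by auto
  qed simp
  then show ?thesis by (simp add: Q_def R_def)
qed

lemma exit_prob_le_block_exit_prob:
  assumes "0 \<le> q" "q \<le> 1" "0 \<le> p" "p \<le> 1"
  shows "exit_prob L q p \<le> block_exit_prob L q p"
  unfolding exit_prob_def block_exit_prob_def using assms blk_self[OF o0]
  by (intro expec_mono) (auto simp: weight_def reach_def)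

text \<open>Opening every edge inside \<open>K\<close> links \<open>o0\<close> to whichever vertex
  of \<open>K\<close> the exit starts from. The price depends on \<open>K\<close> but not on
  \<open>L\<close>.\<close>

lemma block_exit_prob_le_exit_prob:
  assumes L: "saturated L" and c: "0 < c" "c \<le> q" "q \<le> 1 - c" "c \<le> p" "p \<le> 1 - c"
  shows "c ^ card {e \<in> Ed. e \<subseteq> K} * block_exit_prob L q p \<le> exit_prob L q p"
  unfolding block_exit_prob_def exit_prob_def
proof (rule expec_local_modification)
  let ?B = "{e \<in> Ed. e \<subseteq> K}"
  have "e \<noteq> {}" if "e \<in> Ed" for e using edge[OF that] by auto
  then show "?B \<subseteq> touching Ed L" using L by (fastforce simp: touching_def saturated_def)
  fix H assume "reach H K L"
  then obtain k w where k: "k \<in> K" "w \<notin> L" "(k, w) \<in> (adj H)\<^sup>*" by (auto simp: reach_def)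
  have "(o0, k) \<in> (adj (H - ?B \<union> ?B))\<^sup>*"
    using blk_connected[OF o0 k(1)] by (rule adj_rtrancl_mono) auto
  moreover have "(k, w) \<in> (adj (H - ?B \<union> ?B))\<^sup>*"
    using k(3) by (rule adj_rtrancl_mono) auto
  ultimately have "reach (H - ?B \<union> ?B) {o0} L"
    using k(2) unfolding reach_def by (meson rtrancl_trans singletonI)
  then show "\<exists>H'\<subseteq>?B. reach (H - ?B \<union> H') {o0} L" by blast
qed (use c finite_touching_saturated[OF L] in \<open>auto simp: weight_def\<close>)

lemma exit_prob_compare:
  assumes L: "saturated L" and c: "0 < c"
    and q: "c \<le> q1" "q1 \<le> q2" "q2 \<le> 1 - c" and p: "c \<le> p1" "p1 \<le> p2" "p2 \<le> 1 - c"
    and M: "real (2 * (\<kappa> * D)) / c ^ (\<kappa> * D) * (q2 - q1) \<le> p2 - p1"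
  shows "c ^ card {e \<in> Ed. e \<subseteq> K} * exit_prob L q2 p1 \<le> exit_prob L q1 p2"
proof -
  have "c ^ card {e \<in> Ed. e \<subseteq> K} * exit_prob L q2 p1 \<le> c ^ card {e \<in> Ed. e \<subseteq> K} * block_exit_prob L q1 p2"
    using exit_prob_le_block_exit_prob[of q2 p1 L] block_exit_prob_compare[OF assms] c q p by (intro mult_left_mono) auto
  also have "\<dots> \<le> exit_prob L q1 p2" using L c q p by (intro block_exit_prob_le_exit_prob) auto
  finally show ?thesis .
qed

lemma exit_prob_mono:
  assumes L: "saturated L" and "0 \<le> q1" "q1 \<le> q2" "q2 \<le> 1" "0 \<le> p1" "p1 \<le> p2" "p2 \<le> 1"
  shows "exit_prob L q1 p1 \<le> exit_prob L q2 p2"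
  unfolding exit_prob_def using assms finite_touching_saturated[OF L] reach_mono
  by (intro expec_mono_weight) (auto simp: weight_def mono_def)

section \<open>Exhaustion by boxes and the infinite-volume limit\<close>

text \<open>The recursion starts with the neighbours of \<open>K\<close> included, as the last
  clause of \<open>saturated\<close> demands. A set \<open>nbh n\<close> may cut through blocks;
  \<open>box n\<close> fills them up.\<close>

fun nbh :: "nat \<Rightarrow> 'b set" where
  "nbh 0 = K \<union> \<Union>(touching Ed K)"
| "nbh (Suc n) = nbh n \<union> \<Union>(touching Ed (nbh n))"

definition box :: "nat \<Rightarrow> 'b set" where
  "box n = (\<Union>x\<in>nbh n. blk x)"

lemma Union_touching: "finite W \<Longrightarrow> W \<subseteq> X \<Longrightarrow> finite (\<Union>(touching Ed W)) \<and> \<Union>(touching Ed W) \<subseteq> X"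
  using finite_touching[of W] edge by (fastforce simp: touching_def)

lemma finite_nbh: "finite (nbh n) \<and> nbh n \<subseteq> X"
proof (induction n)
  case 0
  then show ?case using Union_touching[of K] blk_finite[OF o0] blk_sub[OF o0] by simp
next
  case (Suc n)
  then show ?case using Union_touching[of "nbh n"] by simp
qed

lemma nbh_mono: "m \<le> n \<Longrightarrow> nbh m \<subseteq> nbh n"
  by (rule lift_Suc_mono_le) auto

lemma nbh_sub_box: "nbh n \<subseteq> box n"
  using finite_nbh[of n] blk_self by (auto simp: box_def)

lemma saturated_box: "saturated (box n)"
proof -
  have 1: "finite (box n)" "box n \<subseteq> X"
    using finite_nbh[of n] blk_finite blk_sub by (auto simp: box_def)
  have "blk y \<subseteq> box n" if y: "y \<in> box n" for y
  proof -
    obtain x where x: "x \<in> nbh n" "y \<in> blk x" using y by (auto simp: box_def)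
    then have "blk y = blk x" using finite_nbh[of n] blk_eq[of x y] by auto
    then show ?thesis using x by (auto simp: box_def)
  qed
  moreover have "K \<subseteq> box n" "\<forall>e\<in>touching Ed K. e \<subseteq> box n"
    using nbh_mono[of 0 n] nbh_sub_box[of n] by auto
  ultimately show ?thesis using 1 by (auto simp: saturated_def)
qed

lemma box_mono: "m \<le> n \<Longrightarrow> box m \<subseteq> box n"
  unfolding box_def using nbh_mono by (intro UN_mono) auto

lemma nbh_exhausts: assumes "x \<in> X" shows "\<exists>n. x \<in> nbh n"
  using connected[OF assms]
proof (induction rule: rtrancl_induct)
  case base
  then show ?case using blk_self[OF o0] by (auto intro!: exI[of _ 0])
next
  case (step y z)
  then obtain n where "y \<in> nbh n" by auto
  then have "z \<in> nbh (Suc n)" using step(2) by (auto simp: adj_def touching_def)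
  then show ?case by blast
qed

lemma finite_sub_box:
  assumes "finite C" "C \<subseteq> X"
  obtains n where "C \<subseteq> box n"
proof -
  have "\<exists>n. C \<subseteq> box n" using assms
  proof (induction C rule: finite_induct)
    case empty
    then show ?case by auto
  next
    case (insert x C)
    then obtain m n where "C \<subseteq> box m" "x \<in> box n"
      using nbh_exhausts[of x] nbh_sub_box by blast
    then have "insert x C \<subseteq> box (max m n)" using box_mono[of m "max m n"] box_mono[of n "max m n"] by auto
    then show ?case by blast
  qed
  then show ?thesis using that by auto
qed

definition open_cluster :: "'b set set \<Rightarrow> 'b set" where
  "open_cluster H = {y. (o0, y) \<in> (adj H)\<^sup>*}"

lemma open_cluster_sub: assumes "H \<subseteq> Ed" shows "open_cluster H \<subseteq> X"
proof
  fix y assume "y \<in> open_cluster H"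
  then have "(o0, y) \<in> (adj H)\<^sup>*" by (simp add: open_cluster_def)
  then show "y \<in> X"
  proof (rule rtrancl_closed)
    fix a b assume "(a, b) \<in> adj H"
    then have "{a, b} \<in> Ed" using assms by (auto simp: adj_def)
    from edge[OF this] show "b \<in> X" by (auto simp: doubleton_eq_iff)
  qed (rule o0)
qed

lemma reach_iff_open_cluster: "reach H {o0} L \<longleftrightarrow> \<not> open_cluster H \<subseteq> L"
  by (auto simp: reach_def open_cluster_def)

lemma infinite_open_cluster_iff:
  assumes "H \<subseteq> Ed"
  shows "infinite (open_cluster H) \<longleftrightarrow> (\<forall>n. reach H {o0} (box n))"
proof
  assume "infinite (open_cluster H)"
  moreover have "finite (box n)" for n using saturated_box[of n] by (simp add: saturated_def)
  ultimately show "\<forall>n. reach H {o0} (box n)" by (metis reach_iff_open_cluster finite_subset)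
next
  assume *: "\<forall>n. reach H {o0} (box n)"
  show "infinite (open_cluster H)"
  proof
    assume "finite (open_cluster H)"
    from finite_sub_box[OF this open_cluster_sub[OF assms]] obtain n where "open_cluster H \<subseteq> box n" .
    then show False using * by (auto simp: reach_iff_open_cluster)
  qed
qed

definition bond_measure :: "real \<Rightarrow> real \<Rightarrow> ('b set \<Rightarrow> bool) measure" where
  "bond_measure q p = PiM Ed (\<lambda>e. measure_pmf (bernoulli_pmf (weight q p e)))"

definition theta :: "real \<Rightarrow> real \<Rightarrow> real" where
  "theta q p = measure (bond_measure q p) {\<omega> \<in> space (bond_measure q p). infinite (open_cluster {e\<in>Ed. \<omega> e})}"

text \<open>The exit events of growing boxes decrease to the event of an infinite cluster, so this
  is continuity of the measure from above.\<close>

lemma exit_prob_tendsto_theta: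
  assumes "0 \<le> q" "q \<le> 1" "0 \<le> p" "p \<le> 1"
  shows "(\<lambda>n. exit_prob (box n) q p) \<longlonglongrightarrow> theta q p"
proof -
  define A where "A n = {\<omega> \<in> space (bond_measure q p). reach {e\<in>Ed. \<omega> e} {o0} (box n)}" for n
  interpret product_prob_space "\<lambda>e. measure_pmf (bernoulli_pmf (weight q p e))" Ed
    by unfold_locales
  have A: "A n \<in> sets (bond_measure q p)" "measure (bond_measure q p) (A n) = exit_prob (box n) q p" for n
  proof -
    let ?S = "touching Ed (box n)"
    have S: "finite ?S" "?S \<subseteq> Ed" using finite_touching_saturated[OF saturated_box] by (auto simp: touching_def)
    have dep: "reach H {o0} (box n) \<longleftrightarrow> reach (H \<inter> ?S) {o0} (box n)" if "H \<subseteq> Ed" for H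
      using that saturated_box[of n] blk_self[OF o0]
      by (intro reach_inter) (auto simp: saturated_def touching_def)
    have w: "0 \<le> weight q p e \<and> weight q p e \<le> 1" for e using assms by (auto simp: weight_def)
    show "A n \<in> sets (bond_measure q p)" "measure (bond_measure q p) (A n) = exit_prob (box n) q p"
      unfolding A_def bond_measure_def exit_prob_def
      by (rule measure_PiM_bernoulli_eq_expec[where P = "\<lambda>H. reach H {o0} (box n)", OF S dep w];
          assumption)+
  qed
  have "decseq A"
    unfolding decseq_def A_def using box_mono by (auto simp: reach_iff_open_cluster)
  then have "(\<lambda>n. measure (bond_measure q p) (A n)) \<longlonglongrightarrow> measure (bond_measure q p) (\<Inter>n. A n)"
    unfolding bond_measure_def using A(1) by (intro finite_Lim_measure_decseq) (auto simp: bond_measure_def)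
  moreover have "(\<Inter>n. A n) = {\<omega> \<in> space (bond_measure q p). infinite (open_cluster {e\<in>Ed. \<omega> e})}"
    by (subst infinite_open_cluster_iff) (auto simp: A_def)
  ultimately show ?thesis by (simp add: A theta_def)
qed

lemma theta_nonneg: "0 \<le> theta q p"
  by (simp add: theta_def)

lemma theta_mono:
  assumes "0 \<le> q1" "q1 \<le> q2" "q2 \<le> 1" "0 \<le> p1" "p1 \<le> p2" "p2 \<le> 1"
  shows "theta q1 p1 \<le> theta q2 p2"
proof (rule LIMSEQ_le)
  show "(\<lambda>n. exit_prob (box n) q1 p1) \<longlonglongrightarrow> theta q1 p1" "(\<lambda>n. exit_prob (box n) q2 p2) \<longlonglongrightarrow> theta q2 p2"
    using assms by (auto intro: exit_prob_tendsto_theta)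
  show "\<exists>N. \<forall>n\<ge>N. exit_prob (box n) q1 p1 \<le> exit_prob (box n) q2 p2"
    using assms saturated_box by (auto intro: exit_prob_mono)
qed

text \<open>Since the factor is positive and independent of the box, \<open>theta q1 p2 = 0\<close>
  forces \<open>theta q2 p1 = 0\<close>, which is the form used for p_c.\<close>

lemma theta_compare:
  assumes c: "0 < c"
    and q: "c \<le> q1" "q1 \<le> q2" "q2 \<le> 1 - c" and p: "c \<le> p1" "p1 \<le> p2" "p2 \<le> 1 - c"
    and M: "real (2 * (\<kappa> * D)) / c ^ (\<kappa> * D) * (q2 - q1) \<le> p2 - p1"
  shows "c ^ card {e \<in> Ed. e \<subseteq> K} * theta q2 p1 \<le> theta q1 p2"
proof (rule LIMSEQ_le)
  show "(\<lambda>n. c ^ card {e \<in> Ed. e \<subseteq> K} * exit_prob (box n) q2 p1) \<longlonglongrightarrow>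
      c ^ card {e \<in> Ed. e \<subseteq> K} * theta q2 p1"
    using c q p by (intro tendsto_mult_left exit_prob_tendsto_theta) auto
  show "(\<lambda>n. exit_prob (box n) q1 p2) \<longlonglongrightarrow> theta q1 p2"
    using c q p by (intro exit_prob_tendsto_theta) auto
  show "\<exists>N. \<forall>n\<ge>N. c ^ card {e \<in> Ed. e \<subseteq> K} * exit_prob (box n) q2 p1 \<le> exit_prob (box n) q1 p2"
    using assms saturated_box by (auto intro!: exit_prob_compare)
qed

text \<open>With outer edges closed, leaving \<open>N (Suc n)\<close> takes an open edge in its cut
  of at most \<open>k\<close> inner edges. The cut is entirely closed with probability at least
  \<open>c ^ k\<close>, independently of the exit from \<open>N n\<close>, so exit probabilities
  decay like \<open>(1 - c ^ k) ^ n\<close>.\<close>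

lemma theta_zero:
  fixes N :: "nat \<Rightarrow> 'b set"
  assumes q: "0 < q" "q < 1"
    and o: "\<And>n. o0 \<in> N n"
    and N: "\<And>n. finite (N n)" "\<And>n. N n \<subseteq> X" "\<And>n. N n \<subseteq> N (Suc n)"
    and inner_step: "\<And>n e. e \<in> inn \<Longrightarrow> e \<inter> N n \<noteq> {} \<Longrightarrow> e \<subseteq> N (Suc n)"
    and cut: "\<And>n. card {e \<in> inn. e \<inter> N n \<noteq> {} \<and> \<not> e \<subseteq> N n} \<le> k"
  shows "theta q 0 = 0"
proof -
  define c where "c = min q (1 - q)"
  have c: "0 < c" "c \<le> q" "c \<le> 1 - q" "c \<le> 1" using q by (auto simp: c_def)
  define S where "S n = touching inn (N n)" for n
  have S_sub: "S n \<subseteq> touching Ed (N n)" for n using inn by (auto simp: S_def touching_def)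
  have fS: "finite (S n)" for n
    using finite_subset[OF S_sub finite_touching[OF N(1) N(2)]] .
  define g where "g n T = expec T (\<lambda>_. q) (\<lambda>H. of_bool (reach H {o0} (N n)))" for n T
  have dep: "reach H {o0} (N n) \<longleftrightarrow> reach (H \<inter> S n) {o0} (N n)" if "H \<subseteq> inn" for H n
    using that o by (intro reach_inter) (auto simp: S_def touching_def)
  have g_eq: "g n T = g n (S n)" if "finite T" "S n \<subseteq> T" "T \<subseteq> inn" for n T
    unfolding g_def
  proof (rule expec_superset[OF that(1,2)])
    fix H assume "H \<subseteq> T"
    then show "of_bool (reach H {o0} (N n)) = (of_bool (reach (H \<inter> S n) {o0} (N n)) :: real)"
      using dep[of H n] that by simp
  qed
  have decay: "g (Suc n) (S (Suc n)) \<le> (1 - c ^ k) * g n (S n)" for n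
  proof -
    define T where "T = S (Suc n)"
    define B where "B = {e \<in> inn. e \<inter> N (Suc n) \<noteq> {} \<and> \<not> e \<subseteq> N (Suc n)}"
    have T: "finite T" "T \<subseteq> inn" "B \<subseteq> T" "S n \<subseteq> T"
      using fS N(3)[of n] by (auto simp: T_def B_def S_def touching_def)
    \<comment> \<open>By \<open>inner_step\<close> the inner edges meeting \<open>N n\<close> lie
      inside \<open>N (Suc n)\<close>, so none is in the next cut, and closing that cut preserves an
      exit from \<open>N n\<close>.\<close>
    have SB: "S n \<inter> B = {}" using inner_step[of _ n] by (auto simp: S_def B_def touching_def)
    let ?P = "\<lambda>H. reach H {o0} (N n)"
    let ?Q = "\<lambda>H. ?P H \<and> H \<inter> B = {}"
    have "c ^ card B * expec T (\<lambda>_. q) (\<lambda>H. of_bool (?P H)) \<le> expec T (\<lambda>_. q) (\<lambda>H. of_bool (?Q H))"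
    proof (rule expec_local_modification)
      fix H assume H: "H \<subseteq> T" "?P H"
      then have "?P (H \<inter> S n)" using dep[of H n] T by simp
      then have "?P (H - B)" using SB by (elim reach_mono) auto
      then show "\<exists>H'\<subseteq>B. ?Q (H - B \<union> H')" by (intro exI[of _ "{}"]) auto
    qed (use T c q in auto)
    moreover have "c ^ k * g n T \<le> c ^ card B * g n T"
      using cut[of "Suc n"] c q unfolding B_def g_def
      by (intro mult_right_mono power_decreasing expec_nonneg) auto
    moreover have "g (Suc n) T \<le> expec T (\<lambda>_. q) (\<lambda>H. of_bool (?P H) - of_bool (?Q H))"
      unfolding g_def
    proof (rule expec_mono)
      fix H assume H: "H \<subseteq> T"
      have "?P H \<and> H \<inter> B \<noteq> {}" if r: "reach H {o0} (N (Suc n))"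
      proof
        show "?P H" using r N(3)[of n] by (auto simp: reach_iff_open_cluster)
        obtain w where "w \<notin> N (Suc n)" "(o0, w) \<in> (adj H)\<^sup>*" using r by (auto simp: reach_def)
        then obtain x y where "(x, y) \<in> adj H" "x \<in> N (Suc n)" "y \<notin> N (Suc n)"
          using rtrancl_exit[of o0 w "adj H" "N (Suc n)"] o by blast
        then have "{x, y} \<in> H \<inter> B" using H T by (auto simp: adj_def B_def)
        then show "H \<inter> B \<noteq> {}" by auto
      qed
      then show "of_bool (reach H {o0} (N (Suc n))) \<le> of_bool (?P H) - (of_bool (?Q H) :: real)"
        by (cases "reach H {o0} (N (Suc n))") auto
    qed (use q in auto)
    ultimately have "g (Suc n) T \<le> (1 - c ^ k) * g n T"
      by (simp add: expec_diff g_def algebra_simps)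
    then show ?thesis using g_eq[OF T(1,4,2)] by (simp add: T_def)
  qed
  have g_le: "g n (S n) \<le> (1 - c ^ k) ^ n" for n
  proof (induction n)
    case 0
    have "g 0 (S 0) \<le> expec (S 0) (\<lambda>_. q) (\<lambda>_. 1)"
      unfolding g_def using q by (intro expec_mono) auto
    then show ?case using fS by (simp add: expec_const)
  next
    case (Suc n)
    have "g (Suc n) (S (Suc n)) \<le> (1 - c ^ k) * g n (S n)" by (rule decay)
    also have "\<dots> \<le> (1 - c ^ k) * (1 - c ^ k) ^ n"
      using Suc c by (intro mult_left_mono) (auto simp: power_le_one)
    finally show ?case by simp
  qed
  have exit_prob_le: "exit_prob (box m) q 0 \<le> g n (S n)" if sub: "N n \<subseteq> box m" for m n
  proof -
    let ?T = "touching Ed (box m)"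
    let ?f = "\<lambda>H. of_bool (reach H {o0} (box m))"
    have fT: "finite ?T" by (rule finite_touching_saturated[OF saturated_box])
    have "exit_prob (box m) q 0 = expec ((?T \<inter> inn) \<union> (?T - inn)) (weight q 0) ?f"
      unfolding exit_prob_def by (simp add: Int_Diff_Un)
    also have "\<dots> = expec (?T \<inter> inn) (weight q 0)
        (\<lambda>G. expec (?T - inn) (weight q 0) (\<lambda>H. ?f (G \<union> H)))"
      using fT by (intro expec_union) auto
    \<comment> \<open>Outer edges have weight 0, so only the empty set of open outer edges
      contributes.\<close>
    also have "\<dots> = expec (?T \<inter> inn) (weight q 0) ?f"
      using fT by (intro expec_cong) (subst expec_null; auto simp: weight_def)
    also have "\<dots> = expec (?T \<inter> inn) (\<lambda>_. q) ?f"
      by (intro expec_cong_weight) (auto simp: weight_def)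
    also have "\<dots> \<le> g n (?T \<inter> inn)"
      unfolding g_def using q sub by (intro expec_mono) (auto simp: reach_iff_open_cluster)
    also have "\<dots> = g n (S n)"
      using fT sub inn by (intro g_eq) (auto simp: S_def touching_def)
    finally show ?thesis .
  qed
  have "theta q 0 \<le> (1 - c ^ k) ^ n" for n
  proof (rule LIMSEQ_le_const2[OF exit_prob_tendsto_theta])
    obtain M where M: "N n \<subseteq> box M" using finite_sub_box[OF N(1,2)] .
    have "exit_prob (box m) q 0 \<le> (1 - c ^ k) ^ n" if "m \<ge> M" for m
    proof -
      have "N n \<subseteq> box m" using M box_mono[OF that] by auto
      from exit_prob_le[OF this] g_le[of n] show ?thesis by linarith
    qed
    then show "\<exists>M. \<forall>m\<ge>M. exit_prob (box m) q 0 \<le> (1 - c ^ k) ^ n" by blast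
  qed (use q in auto)
  moreover have "(\<lambda>n. (1 - c ^ k) ^ n) \<longlonglongrightarrow> 0"
    using c by (intro LIMSEQ_power_zero) (auto simp: power_le_one)
  ultimately have "theta q 0 \<le> 0" by (intro LIMSEQ_le_const) auto
  then show ?thesis using theta_nonneg[of q 0] by linarith
qed

end

section \<open>Ladder graphs\<close>

lemma graph_path_imp_rtrancl:
  "graph_path V E x xs y \<Longrightarrow> x \<in> V \<and> y \<in> V \<and> (x, y) \<in> (adj E)\<^sup>*"
proof (induction xs arbitrary: x)
  case Nil
  then show ?case by (simp add: graph_path_def)
next
  case (Cons a xs)
  show ?case
  proof (cases xs)
    case Nil
    then show ?thesis using Cons.prems by (auto simp: graph_path_def)
  next
    case (Cons b ys)
    then have "graph_path V E b xs y" "{a, b} \<in> E" "a = x" "a \<in> V"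
      using Cons.prems by (auto simp: graph_path_def successively_Cons)
    then show ?thesis using Cons.IH[of b]
      by (auto intro: converse_rtrancl_into_rtrancl simp: adj_def)
  qed
qed

lemma rtrancl_imp_graph_path:
  assumes "(x, y) \<in> (adj E)\<^sup>*" "x \<in> V" "\<And>e. e \<in> E \<Longrightarrow> e \<subseteq> V"
  shows "\<exists>xs. graph_path V E x xs y"
  using assms(1)
proof (induction rule: rtrancl_induct)
  case base
  have "graph_path V E x [x] x" using assms by (simp add: graph_path_def)
  then show ?case ..
next
  case (step y z)
  then obtain xs where "graph_path V E x xs y" by auto
  then have "graph_path V E x (xs @ [z]) z"
    using step(2) assms(3)[of "{y, z}"]
    by (auto simp: graph_path_def adj_def successively_append_iff)
  then show ?case ..
qed

definition layer :: "int \<Rightarrow> 'a set set \<Rightarrow> ('a \<times> int) set set" where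
  "layer i G = {{(a, i), (b, i)} | a b. {a, b} \<in> G}"

lemma layer_rtrancl: "(a, b) \<in> (adj G)\<^sup>* \<Longrightarrow> ((a, i), (b, i)) \<in> (adj (layer i G))\<^sup>*"
proof (induction rule: rtrancl_induct)
  case (step y z)
  then have "((y, i), (z, i)) \<in> adj (layer i G)" by (auto simp: adj_def layer_def)
  then show ?case using step by (auto intro: rtrancl_into_rtrancl)
qed simp

lemma layer_mono: "G \<subseteq> G' \<Longrightarrow> layer i G \<subseteq> layer i G'"
  by (auto simp: layer_def)

lemma layer_edge: "{(a, m), (b, l)} \<in> layer i G \<longleftrightarrow> m = i \<and> l = i \<and> {a, b} \<in> G"
  unfolding layer_def by (auto simp: doubleton_eq_iff insert_commute)

section \<open>Strips, their extra vertices and the blocks\<close>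

locale ladder_perc =
  fixes V :: "'a set" and E :: "'a set set"
    and U :: "nat \<Rightarrow> 'a set" and F :: "nat \<Rightarrow> 'a set set" and v :: 'a and D k :: nat
  assumes simple: "simple_graph V E" and inf: "infinite V" and conn: "connected_graph V E"
    and deg: "\<And>x. x \<in> V \<Longrightarrow> finite {e\<in>E. x \<in> e} \<and> card {e\<in>E. x \<in> e} \<le> D"
    and sub: "\<And>r. subgraph_of (U r) (F r) V E"
    and finU: "\<And>r. finite (U r)"
    and connU: "\<And>r. connected_graph (U r) (F r)"
    and far: "\<And>i j. i \<noteq> j \<Longrightarrow> graph_setdist V E (U i) (U j) \<ge> 3"
    and cardU: "\<And>r. card (U r) \<le> k"
    and v: "v \<in> V"
begin

lemma E_edge: "{a, b} \<in> E \<Longrightarrow> a \<in> V \<and> b \<in> V \<and> a \<noteq> b"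
  using simple unfolding simple_graph_def by (metis doubleton_eq_iff)

lemma F_edge: "{a, b} \<in> F r \<Longrightarrow> a \<in> U r \<and> b \<in> U r \<and> a \<noteq> b"
  using sub[of r] unfolding subgraph_of_def simple_graph_def by (metis doubleton_eq_iff)

lemma F_sub: "F r \<subseteq> E" and U_sub: "U r \<subseteq> V"
  using sub[of r] by (auto simp: subgraph_of_def)

lemma E_rtrancl: "a \<in> V \<Longrightarrow> b \<in> V \<Longrightarrow> (a, b) \<in> (adj E)\<^sup>*"
  using conn graph_path_imp_rtrancl unfolding connected_graph_def by metis

lemma F_rtrancl: "a \<in> U r \<Longrightarrow> b \<in> U r \<Longrightarrow> (a, b) \<in> (adj (F r))\<^sup>*"
  using connU[of r] graph_path_imp_rtrancl unfolding connected_graph_def by metis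

text \<open>Three edges make four vertices. Below, the bound is contradicted by lists of one, two
  and three vertices: a common vertex of two strips, some \<open>w0 i\<close> in another
  \<open>U j\<close>, and a shared \<open>w0\<close>.\<close>

lemma far_path:
  assumes "i \<noteq> j" "a \<in> U i" "b \<in> U j" "graph_path V E a xs b"
  shows "length xs \<ge> 4"
proof -
  have "3 \<le> graph_setdist V E (U i) (U j)" using far assms by auto
  also have "\<dots> \<le> (INF y\<in>U j. graph_dist V E a y)"
    unfolding graph_setdist_def using assms by (intro INF_lower)
  also have "\<dots> \<le> graph_dist V E a b" using assms by (intro INF_lower)
  also have "\<dots> \<le> enat (length xs - 1)"
    unfolding graph_dist_def using assms by (intro INF_lower) auto
  finally have "enat 3 \<le> enat (length xs - 1)" by (simp add: numeral_eq_enat)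
  then show ?thesis by simp
qed

lemma exists_exit: "\<exists>u w. u \<in> U r \<and> w \<in> V \<and> w \<notin> U r \<and> {u, w} \<in> E"
proof -
  obtain a where a: "a \<in> U r" using connU[of r] by (auto simp: connected_graph_def)
  obtain b where b: "b \<in> V" "b \<notin> U r" using inf finU[of r] by (meson finite_subset subsetI)
  then have "(a, b) \<in> (adj E)\<^sup>*" using a U_sub by (intro E_rtrancl) auto
  then obtain x y where "(x, y) \<in> adj E" "x \<in> U r" "y \<notin> U r"
    using a b by (elim rtrancl_exit)
  then show ?thesis using E_edge[of x y] by (auto simp: adj_def)
qed

definition u0 :: "nat \<Rightarrow> 'a" where
  "u0 r = (SOME u. \<exists>w. u \<in> U r \<and> w \<in> V \<and> w \<notin> U r \<and> {u, w} \<in> E)"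

definition w0 :: "nat \<Rightarrow> 'a" where
  "w0 r = (SOME w. u0 r \<in> U r \<and> w \<in> V \<and> w \<notin> U r \<and> {u0 r, w} \<in> E)"

lemma w0: "u0 r \<in> U r" "w0 r \<in> V" "w0 r \<notin> U r" "{u0 r, w0 r} \<in> E"
proof -
  have "\<exists>w. u0 r \<in> U r \<and> w \<in> V \<and> w \<notin> U r \<and> {u0 r, w} \<in> E"
    unfolding u0_def using exists_exit by (rule someI_ex)
  then have "u0 r \<in> U r \<and> w0 r \<in> V \<and> w0 r \<notin> U r \<and> {u0 r, w0 r} \<in> E"
    unfolding w0_def by (rule someI_ex)
  then show "u0 r \<in> U r" "w0 r \<in> V" "w0 r \<notin> U r" "{u0 r, w0 r} \<in> E" by auto
qed

definition N :: "nat \<Rightarrow> 'a set" where "N r = insert (w0 r) (U r)"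

text \<open>Connects \<open>N r\<close> by the given subgraph and a single edge to
  \<open>w0 r\<close>; \<open>F r\<close> need not be induced.\<close>

definition H :: "nat \<Rightarrow> 'a set set" where "H r = insert {u0 r, w0 r} (F r)"

lemma U_disjoint: "a \<in> U i \<Longrightarrow> a \<in> U j \<Longrightarrow> i = j"
  using far_path[of i j a a "[a]"] U_sub by (auto simp: graph_path_def)

lemma w0_notin_U: "w0 i \<notin> U j"
proof
  assume w: "w0 i \<in> U j"
  then have "i \<noteq> j" using w0(3)[of j] by auto
  moreover have "graph_path V E (u0 i) [u0 i, w0 i] (w0 i)"
    using w0[of i] U_sub[of i] by (auto simp: graph_path_def)
  ultimately show False using far_path[of i j "u0 i" "w0 i"] w w0(1)[of i] by fastforce
qed

lemma w0_inj: "w0 i = w0 j \<Longrightarrow> i = j"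
proof (rule ccontr)
  assume w: "w0 i = w0 j" "i \<noteq> j"
  have "graph_path V E (u0 i) [u0 i, w0 i, u0 j] (u0 j)"
    using w0[of i] w0[of j] U_sub[of i] U_sub[of j] w by (auto simp: graph_path_def insert_commute)
  then show False using far_path[of i j "u0 i" "u0 j"] w w0(1)[of i] w0(1)[of j] by fastforce
qed

lemma N_disjoint: "a \<in> N i \<Longrightarrow> a \<in> N j \<Longrightarrow> i = j"
  using U_disjoint w0_notin_U w0_inj by (auto simp: N_def)

lemma N_sub: "N r \<subseteq> V" and finN: "finite (N r)" and cardN: "card (N r) \<le> Suc k"
proof -
  show "N r \<subseteq> V" using w0[of r] U_sub by (auto simp: N_def)
  show "finite (N r)" using finU by (simp add: N_def)
  have "card (N r) \<le> Suc (card (U r))" unfolding N_def by (rule card_insert_le_m1) auto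
  then show "card (N r) \<le> Suc k" using cardU[of r] by linarith
qed

lemma H_edge: "{a, b} \<in> H r \<Longrightarrow> {a, b} \<in> E \<and> a \<in> N r \<and> b \<in> N r"
  using w0[of r] F_edge[of a b r] F_sub[of r] by (auto simp: H_def N_def doubleton_eq_iff insert_commute)

lemma H_rtrancl:
  assumes "a \<in> N r" "b \<in> N r"
  shows "(a, b) \<in> (adj (H r))\<^sup>*"
proof -
  have *: "(u0 r, c) \<in> (adj (H r))\<^sup>*" if "c \<in> N r" for c
  proof (cases "c = w0 r")
    case True
    then show ?thesis by (auto intro!: adj_edge simp: H_def)
  next
    case False
    then have "(u0 r, c) \<in> (adj (F r))\<^sup>*" using that w0(1) by (intro F_rtrancl) (auto simp: N_def)
    then show ?thesis by (rule adj_rtrancl_mono) (auto simp: H_def)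
  qed
  show ?thesis using *[OF assms(1)] *[OF assms(2)] by (meson adj_rtrancl_sym rtrancl_trans)
qed

abbreviation X where "X \<equiv> ladder_vertices V"
abbreviation Ed where "Ed \<equiv> ladder_edges V E"
abbreviation inn where "inn \<equiv> inner_edges U F"

text \<open>\<open>THE\<close> is well defined by \<open>N_disjoint\<close>. Vertices over no
  \<open>N r\<close> form singleton blocks, so that the blocks partition the ladder.\<close>

definition blk :: "'a \<times> int \<Rightarrow> ('a \<times> int) set" where
  "blk z = (if \<exists>r. fst z \<in> N r
     then N (THE r. fst z \<in> N r) \<times> {2 * (snd z div 2), 2 * (snd z div 2) + 1} else {z})"

lemma blk_N: "u \<in> N r \<Longrightarrow> blk (u, n) = N r \<times> {2 * (n div 2), 2 * (n div 2) + 1}"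
proof -
  assume u: "u \<in> N r"
  then have "(THE r. u \<in> N r) = r" using N_disjoint by blast
  then show ?thesis using u by (auto simp: blk_def)
qed

lemma blk_other: "(\<And>r. u \<notin> N r) \<Longrightarrow> blk (u, n) = {(u, n)}"
  by (auto simp: blk_def)

lemma horizontal: "{(a, n), (b, n)} \<in> Ed \<longleftrightarrow> {a, b} \<in> E"
  unfolding ladder_edges_def by (auto simp: doubleton_eq_iff insert_commute)

lemma vertical: "{(a, n), (a, n + 1)} \<in> Ed \<longleftrightarrow> a \<in> V"
  unfolding ladder_edges_def by (auto simp: doubleton_eq_iff dest: E_edge)

lemma layer_sub: "G \<subseteq> E \<Longrightarrow> layer i G \<subseteq> Ed"
  by (auto simp: layer_def ladder_edges_def)

lemma inner_cases:
  assumes "e \<in> inn"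
  obtains (hor) r a b n where "e = {(a, n), (b, n)}" "{a, b} \<in> F r" "a \<in> U r" "b \<in> U r"
    | (ver) r a n where "e = {(a, n), (a, n + 1)}" "a \<in> U r"
  using assms F_edge unfolding inner_edges_def ladder_edges_def by blast

text \<open>Since the sets \<open>N r\<close> are disjoint, an inner edge at a vertex over
  \<open>N r\<close> belongs to the strip over \<open>U r\<close>. In particular no inner edge ends
  over \<open>w0 r\<close>, so the rung there is outer.\<close>

lemma inner_exit:
  assumes "{(a, m), (b, l)} \<in> inn" "a \<in> N r"
  shows "a \<in> U r \<and> b \<in> U r \<and> (m = l \<or> a = b \<and> (l = m + 1 \<or> m = l + 1))"
  using assms(1)
proof (cases rule: inner_cases)
  case (hor s c d n)
  then have "a \<in> U s" "b \<in> U s" "m = l" by (auto simp: doubleton_eq_iff)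
  then show ?thesis using N_disjoint[of a r s] assms(2) by (auto simp: N_def)
next
  case (ver s c n)
  then have "a \<in> U s" "b \<in> U s" "a = b" "l = m + 1 \<or> m = l + 1" by (auto simp: doubleton_eq_iff)
  then show ?thesis using N_disjoint[of a r s] assms(2) by (auto simp: N_def)
qed

text \<open>An outer edge \<open>f\<close> of the block \<open>W\<close> that is a bridge between \<open>x\<close> and \<open>y\<close> in a suitable set of
  edges inside \<open>W\<close>; \<open>C\<close> is the side of \<open>x\<close>.\<close>

definition bridged :: "('a \<times> int) set \<Rightarrow> 'a \<times> int \<Rightarrow> 'a \<times> int \<Rightarrow> bool" where
  "bridged W x y \<longleftrightarrow> (\<exists>\<eta> f C. f \<in> Ed - inn \<and> f \<subseteq> W \<and> f \<notin> \<eta> \<and> \<eta> \<subseteq> Ed \<and> (\<forall>e\<in>\<eta>. e \<subseteq> W) \<and>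
     (x, y) \<in> (adj (insert f \<eta>))\<^sup>* \<and> x \<in> C \<and> y \<notin> C \<and> C \<subseteq> W \<and>
     (\<forall>a b. {a, b} \<in> \<eta> \<longrightarrow> a \<in> C \<longrightarrow> b \<in> C))"

text \<open>\<open>W - C\<close> is the side of \<open>y\<close>: closure under
  \<open>\<eta>\<close> passes to the complement because edges are unordered.\<close>

lemma bridged_sym:
  assumes "bridged W x y" "y \<in> W"
  shows "bridged W y x"
proof -
  obtain \<eta> f C where *: "f \<in> Ed - inn" "f \<subseteq> W" "f \<notin> \<eta>" "\<eta> \<subseteq> Ed" "\<forall>e\<in>\<eta>. e \<subseteq> W"
     "(x, y) \<in> (adj (insert f \<eta>))\<^sup>*" "x \<in> C" "y \<notin> C" "C \<subseteq> W"
     "\<forall>a b. {a, b} \<in> \<eta> \<longrightarrow> a \<in> C \<longrightarrow> b \<in> C"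
    using assms(1) unfolding bridged_def by (elim exE conjE) (rule that; assumption)
  have "b \<in> W - C" if "{a, b} \<in> \<eta>" "a \<in> W - C" for a b
  proof -
    have "{b, a} \<in> \<eta>" using that by (simp add: insert_commute)
    then show ?thesis using * that by blast
  qed
  then show ?thesis
    unfolding bridged_def using * assms(2) adj_rtrancl_sym[OF *(6)]
    by (intro exI[of _ \<eta>] exI[of _ f] exI[of _ "W - C"]) auto
qed

text \<open>The order of \<open>i\<close> and \<open>j\<close> is left open so that the layer of the
  first point may be the lower or the upper one.\<close>

context
  fixes r :: nat and i j :: int
  assumes ij: "j = i + 1 \<or> i = j + 1"
begin

abbreviation W where "W \<equiv> N r \<times> {i, j}"

lemma vert_Ed: "a \<in> V \<Longrightarrow> {(a, i), (a, j)} \<in> Ed"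
  using vertical[of a i] vertical[of a j] ij by (auto simp: insert_commute)

lemma vert_outer: "{(w0 r, i), (w0 r, j)} \<in> Ed - inn" "{(w0 r, i), (w0 r, j)} \<subseteq> W"
proof -
  have "{(w0 r, i), (w0 r, j)} \<notin> inn"
    using inner_exit[of "w0 r" i "w0 r" j r] w0_notin_U[of r r] by (auto simp: N_def)
  then show "{(w0 r, i), (w0 r, j)} \<in> Ed - inn" using vert_Ed w0(2) by auto
  show "{(w0 r, i), (w0 r, j)} \<subseteq> W" by (auto simp: N_def)
qed

lemma layer_H: "layer n (H r) \<subseteq> Ed" "e \<in> layer n (H r) \<Longrightarrow> e \<subseteq> N r \<times> {n}"
  using H_edge by (auto simp: layer_def horizontal)

lemma vert_notin_layer: "{(a, i), (a, j)} \<notin> layer n G"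
  using ij by (auto simp: layer_edge)

lemma W_connected:
  assumes "x \<in> W" "y \<in> W"
  shows "(x, y) \<in> (adj {e \<in> Ed. e \<subseteq> W})\<^sup>*"
proof -
  let ?I = "{e \<in> Ed. e \<subseteq> W}"
  have layer: "layer n (H r) \<subseteq> ?I" if "n \<in> {i, j}" for n using layer_H(1)[of n] layer_H(2)[of _ n] that by auto
  have hor: "((a, n), (b, n)) \<in> (adj ?I)\<^sup>*" if "a \<in> N r" "b \<in> N r" "n \<in> {i, j}" for a b n
    using layer_rtrancl[OF H_rtrancl[OF that(1,2)]] layer[OF that(3)] by (rule adj_rtrancl_mono)
  have ver: "((w0 r, i), (w0 r, j)) \<in> (adj ?I)\<^sup>*"
    using vert_outer by (intro adj_edge) auto
  have ver': "((w0 r, m), (w0 r, n)) \<in> (adj ?I)\<^sup>*" if "m \<in> {i, j}" "n \<in> {i, j}" for m n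
    using that ver adj_rtrancl_sym[OF ver] by auto
  have w: "w0 r \<in> N r" by (simp add: N_def)
  obtain a m b n where xy: "x = (a, m)" "y = (b, n)" by (cases x, cases y)
  then have 1: "a \<in> N r" "b \<in> N r" "m \<in> {i, j}" "n \<in> {i, j}" using assms by auto
  show ?thesis unfolding xy using hor[OF 1(1) w 1(3)] ver'[OF 1(3,4)] hor[OF w 1(2,4)]
    by (meson rtrancl_trans)
qed

text \<open>With both layers connected inside and no other rung open, the rung over
  \<open>w0 r\<close> is the only link; the side of the first point is its layer.\<close>

lemma bridged_diff:
  assumes "u \<in> U r" "u' \<in> U r"
  shows "bridged W (u, i) (u', j)"
proof -
  let ?f = "{(w0 r, i), (w0 r, j)}" and ?\<eta> = "layer i (H r) \<union> layer j (H r)"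
  have N: "u \<in> N r" "u' \<in> N r" "w0 r \<in> N r" using assms by (auto simp: N_def)
  have "((u, i), (w0 r, i)) \<in> (adj (insert ?f ?\<eta>))\<^sup>*"
    using layer_rtrancl[OF H_rtrancl[OF N(1,3)]] by (rule adj_rtrancl_mono) auto
  moreover have "((w0 r, i), (w0 r, j)) \<in> (adj (insert ?f ?\<eta>))\<^sup>*" by (intro adj_edge) auto
  moreover have "((w0 r, j), (u', j)) \<in> (adj (insert ?f ?\<eta>))\<^sup>*"
    using layer_rtrancl[OF H_rtrancl[OF N(3,2)]] by (rule adj_rtrancl_mono) auto
  ultimately have path: "((u, i), (u', j)) \<in> (adj (insert ?f ?\<eta>))\<^sup>*" by (meson rtrancl_trans)
  have closed: "\<forall>a b. {a, b} \<in> ?\<eta> \<longrightarrow> a \<in> N r \<times> {i} \<longrightarrow> b \<in> N r \<times> {i}"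
    using ij H_edge by (auto simp: layer_edge)
  show ?thesis unfolding bridged_def
  proof (intro exI conjI)
    show "?f \<in> Ed - inn" "?f \<subseteq> W" using vert_outer by auto
    show "?f \<notin> ?\<eta>" by (simp add: vert_notin_layer)
    show "?\<eta> \<subseteq> Ed" using layer_H(1) by auto
    show "\<forall>e\<in>?\<eta>. e \<subseteq> W" using layer_H(2) by blast
    show "((u, i), (u', j)) \<in> (adj (insert ?f ?\<eta>))\<^sup>*" by (rule path)
    show "\<forall>a b. {a, b} \<in> ?\<eta> \<longrightarrow> a \<in> N r \<times> {i} \<longrightarrow> b \<in> N r \<times> {i}" by (rule closed)
  qed (use N ij in auto)
qed

text \<open>The route runs from \<open>u\<close> through \<open>T\<close> to \<open>w0 r\<close> in
  layer \<open>i\<close>, over the rung there, through layer \<open>j\<close> to below or above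
  \<open>u'\<close>, and along the rung over \<open>u'\<close>. Layer \<open>i\<close> is opened
  only on \<open>insert u T\<close>, which misses \<open>u'\<close>, so the rung over
  \<open>w0 r\<close> stays the only way across.\<close>

lemma bridged_detour:
  assumes u: "u \<in> U r" "u' \<in> U r" "u \<noteq> u'"
    and T: "T = {t. (w0 r, t) \<in> (adj {e \<in> H r. u \<notin> e \<and> u' \<notin> e})\<^sup>*}"
    and t: "t \<in> T" "{t, u} \<in> H r"
  shows "bridged W (u, i) (u', i)"
proof -
  let ?G = "{e \<in> H r. e \<subseteq> insert u T}"
  let ?f = "{(w0 r, i), (w0 r, j)}" and ?\<eta> = "insert {(u', i), (u', j)} (layer i ?G \<union> layer j (H r))"
  let ?A = "adj (insert ?f ?\<eta>)" and ?C = "(insert u T) \<times> {i}"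
  have N: "u \<in> N r" "u' \<in> N r" "w0 r \<in> N r" using assms by (auto simp: N_def)
  have TN: "s \<in> N r - {u, u'}" if "s \<in> T" for s
  proof -
    have "(w0 r, s) \<in> (adj {e \<in> H r. u \<notin> e \<and> u' \<notin> e})\<^sup>*" using that T by auto
    then show ?thesis
    proof (rule rtrancl_closed)
      show "w0 r \<in> N r - {u, u'}" using N u w0_notin_U by auto
    qed (auto simp: adj_def dest: H_edge)
  qed
  have TG: "(w0 r, s) \<in> (adj ?G)\<^sup>*" if "s \<in> T" for s
  proof -
    have "(w0 r, s) \<in> (adj {e \<in> H r. u \<notin> e \<and> u' \<notin> e})\<^sup>*" using that T by auto
    then show ?thesis
    proof (induction rule: rtrancl_induct)
      case (step y z)
      have "y \<in> T" "z \<in> T" using step(1,2) T by (auto intro: rtrancl_into_rtrancl)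
      then have "(y, z) \<in> adj ?G" using step(2) by (auto simp: adj_def)
      then show ?case using step(3) by (auto intro: rtrancl_into_rtrancl)
    qed simp
  qed
  have "(t, u) \<in> adj ?G" using t by (auto simp: adj_def)
  then have "(w0 r, u) \<in> (adj ?G)\<^sup>*" using TG[OF t(1)] by (auto intro: rtrancl_into_rtrancl)
  then have "((u, i), (w0 r, i)) \<in> (adj (layer i ?G))\<^sup>*" by (rule layer_rtrancl[OF adj_rtrancl_sym])
  then have "((u, i), (w0 r, i)) \<in> ?A\<^sup>*" by (rule adj_rtrancl_mono) auto
  moreover have "((w0 r, i), (w0 r, j)) \<in> ?A\<^sup>*" by (intro adj_edge) auto
  moreover have "((w0 r, j), (u', j)) \<in> ?A\<^sup>*"
    using layer_rtrancl[OF H_rtrancl[OF N(3,2)]] by (rule adj_rtrancl_mono) auto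
  moreover have "((u', j), (u', i)) \<in> ?A\<^sup>*" by (intro adj_edge) (auto simp: insert_commute)
  ultimately have path: "((u, i), (u', i)) \<in> ?A\<^sup>*" by (meson rtrancl_trans)
  have closed: "b \<in> ?C" if ab: "{a, b} \<in> ?\<eta>" "a \<in> ?C" for a b
  proof -
    obtain c where c: "a = (c, i)" "c \<in> insert u T" using ab by auto
    then have "c \<noteq> u'" using TN u by auto
    then have "{a, b} \<noteq> {(u', i), (u', j)}" using c by (auto simp: doubleton_eq_iff)
    moreover have "{a, b} \<notin> layer j (H r)" using c ij by (cases b) (auto simp: layer_edge)
    ultimately have "{a, b} \<in> layer i ?G" using ab by auto
    then show ?thesis using c by (cases b) (auto simp: layer_edge)
  qed
  have G: "layer i ?G \<subseteq> layer i (H r)" by (rule layer_mono) auto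
  show ?thesis unfolding bridged_def
  proof (intro exI conjI)
    show "?f \<in> Ed - inn" "?f \<subseteq> W" using vert_outer by auto
    have "w0 r \<noteq> u'" using u w0_notin_U by auto
    then show "?f \<notin> ?\<eta>" by (simp add: vert_notin_layer doubleton_eq_iff)
    show "?\<eta> \<subseteq> Ed" using layer_H(1) G vert_Ed N_sub N by blast
    show "\<forall>e\<in>?\<eta>. e \<subseteq> W"
    proof
      fix e assume "e \<in> ?\<eta>"
      then consider "e = {(u', i), (u', j)}" | "e \<in> layer i (H r)" | "e \<in> layer j (H r)" using G by blast
      then show "e \<subseteq> W" using N layer_H(2) by cases blast+
    qed
    show "((u, i), (u', i)) \<in> ?A\<^sup>*" by (rule path)
    show "\<forall>a b. {a, b} \<in> ?\<eta> \<longrightarrow> a \<in> ?C \<longrightarrow> b \<in> ?C" using closed by blast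
    show "?C \<subseteq> W" using TN N by auto
    show "(u', i) \<notin> ?C" using TN u by auto
  qed auto
qed

text \<open>\<open>T\<close> collects what \<open>w0 r\<close> reaches without \<open>u\<close> and
  \<open>u'\<close>. As \<open>H r\<close> connects \<open>w0 r\<close> to \<open>u\<close>, some
  edge leaves \<open>T\<close>, necessarily to \<open>u\<close> or \<open>u'\<close>; in the latter
  case the roles are swapped.\<close>

lemma bridged_same:
  assumes u: "u \<in> U r" "u' \<in> U r" "u \<noteq> u'"
  shows "bridged W (u, i) (u', i)"
proof -
  define T where "T = {t. (w0 r, t) \<in> (adj {e \<in> H r. u \<notin> e \<and> u' \<notin> e})\<^sup>*}"
  have uT: "u \<notin> T" "u' \<notin> T"
  proof -
    have "s \<in> - {u, u'}" if "s \<in> T" for s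
      using that unfolding T_def mem_Collect_eq
      by (rule rtrancl_closed) (use u w0_notin_U in \<open>auto simp: adj_def\<close>)
    then show "u \<notin> T" "u' \<notin> T" by auto
  qed
  have "(w0 r, u) \<in> (adj (H r))\<^sup>*" using u by (intro H_rtrancl) (auto simp: N_def)
  then obtain s t where st: "(s, t) \<in> adj (H r)" "s \<in> T" "t \<notin> T"
    using rtrancl_exit[of "w0 r" u "adj (H r)" T] uT by (auto simp: T_def)
  have "t = u \<or> t = u'"
  proof (rule ccontr)
    assume "\<not> ?thesis"
    then have "(s, t) \<in> adj {e \<in> H r. u \<notin> e \<and> u' \<notin> e}" using st uT by (auto simp: adj_def)
    then have "t \<in> T" using st(2) unfolding T_def by (auto intro: rtrancl_into_rtrancl)
    then show False using st by auto
  qed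
  then show ?thesis
  proof
    assume "t = u"
    then show ?thesis using bridged_detour[OF u T_def st(2)] st(1) by (auto simp: adj_def)
  next
    assume t: "t = u'"
    have T': "T = {t. (w0 r, t) \<in> (adj {e \<in> H r. u' \<notin> e \<and> u \<notin> e})\<^sup>*}"
      unfolding T_def by (simp add: conj_commute)
    have "bridged W (u', i) (u, i)"
      using bridged_detour[OF u(2,1) _ T' st(2)] t st(1) u(3) by (auto simp: adj_def)
    then show ?thesis by (rule bridged_sym) (use u in \<open>auto simp: N_def\<close>)
  qed
qed

end

lemma bridged_block:
  assumes x: "x \<in> U r \<times> {m, m + 1}" and y: "y \<in> U r \<times> {m, m + 1}" and "x \<noteq> y"
  shows "bridged (N r \<times> {m, m + 1}) x y"
proof -
  obtain u i u' j where xy: "x = (u, i)" "y = (u', j)" by (cases x, cases y)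
  then have u: "u \<in> U r" "u' \<in> U r" and ij: "i = m \<or> i = m + 1" "j = m \<or> j = m + 1"
    using x y by auto
  show ?thesis
  proof (cases "i = j")
    case True
    then have ne: "u \<noteq> u'" using xy assms by auto
    define i' where "i' = (if i = m then m + 1 else m)"
    have i': "i' = i + 1 \<or> i = i' + 1" "{i, i'} = {m, m + 1}" using ij(1) by (auto simp: i'_def)
    show ?thesis using bridged_same[OF i'(1) u ne] True xy i'(2) by simp
  next
    case False
    then have i': "j = i + 1 \<or> i = j + 1" "{i, j} = {m, m + 1}" using ij by auto
    show ?thesis using bridged_diff[OF i'(1) u] xy i'(2) by simp
  qed
qed

text \<open>A horizontal inner edge at the block keeps its height and stays over \<open>U r\<close>,
  so only a rung can leave.\<close>

lemma inner_leaves_block: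
  assumes e: "{(b, l), (a, i)} \<in> inn" and a: "(a, i) \<in> N r \<times> {m, m + 1}" "(b, l) \<notin> N r \<times> {m, m + 1}"
  shows "a = b \<and> a \<in> U r \<and> l = (if i = m then m - 1 else m + 2)"
proof -
  have "{(a, i), (b, l)} \<in> inn" using e by (simp add: insert_commute)
  then have *: "a \<in> U r" "b \<in> U r" "i = l \<or> a = b \<and> (l = i + 1 \<or> i = l + 1)"
    using inner_exit[of a i b l r] a by auto
  then have "b \<in> N r" by (auto simp: N_def)
  then show ?thesis using * a by auto
qed

lemma rewire_ladder:
  assumes e: "e \<in> inn" "z \<in> e"
    and edges: "{x', x} \<in> Ed" "{y, y'} \<in> Ed" and xy: "x \<in> blk z" "y \<in> blk z"
    and out: "x' \<notin> blk z" "y' \<notin> blk z" "x' \<noteq> y'"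
  shows "\<exists>\<eta> f C. f \<in> touching Ed (blk z) - inn \<and> f \<notin> \<eta> \<and> \<eta> \<subseteq> touching Ed (blk z) \<and>
         (\<forall>e\<in>\<eta>. e \<subseteq> blk z \<union> {x', y'}) \<and>
         (x', y') \<in> (adj (insert f \<eta>))\<^sup>* \<and> x' \<in> C \<and> y' \<notin> C \<and> C \<subseteq> insert x' (blk z) \<and>
         (\<forall>a b. {a, b} \<in> \<eta> \<longrightarrow> a \<in> C \<longrightarrow> b \<in> C)"
proof -
  obtain r u n where z: "z = (u, n)" "u \<in> U r"
    using e by (auto elim!: inner_cases)
  define m where "m = 2 * (n div 2)"
  have W: "blk z = N r \<times> {m, m + 1}" unfolding z m_def using z by (intro blk_N) (auto simp: N_def)
  let ?W = "N r \<times> {m, m + 1}"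
  define I where "I = {e \<in> Ed. e \<subseteq> ?W}"
  note xy = xy[unfolded W] and out = out[unfolded W]
  have "e \<noteq> {}" if "e \<in> Ed" for e using that by (auto simp: ladder_edges_def)
  then have It: "I \<subseteq> touching Ed ?W" by (auto simp: I_def touching_def)
  have t: "{x', x} \<in> touching Ed ?W" "{y, y'} \<in> touching Ed ?W"
    using edges xy by (auto simp: touching_def)
  have conn_I: "(x, y) \<in> (adj I)\<^sup>*"
    unfolding I_def using W_connected[of "m + 1" m x r y] xy by auto
  have ne': "{x', x} \<noteq> {y, y'}" using out xy by (auto simp: doubleton_eq_iff)
  have path: "(x', y') \<in> (adj G)\<^sup>*"
    if "{x', x} \<in> G" "{y, y'} \<in> G" "(x, y) \<in> (adj G)\<^sup>*" for G
    using adj_edge[OF that(1)] that(3) adj_edge[OF that(2)] by (meson rtrancl_trans)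
  have I_in: "a \<in> ?W \<and> b \<in> ?W" if "{a, b} \<in> I" for a b using that by (auto simp: I_def)
  have notI: "{x', x} \<notin> I" "{y, y'} \<notin> I" using I_in out by blast+
  have neq: "x' \<noteq> y" "x \<noteq> y'" using xy out by blast+
  consider (x) "{x', x} \<notin> inn" | (y) "{y, y'} \<notin> inn" | (inner) "{x', x} \<in> inn" "{y, y'} \<in> inn"
    by blast
  then show ?thesis
  proof cases
    \<comment> \<open>An outer entry edge is itself the bridge. Here the side of \<open>x'\<close>
      is the single point \<open>x'\<close>; in the mirrored case it also contains the whole
      block.\<close>
    case x
    show ?thesis unfolding W
    proof (intro exI conjI)
      show "{x', x} \<in> touching Ed ?W - inn" using x t by auto
      show "{x', x} \<notin> insert {y, y'} I" using ne' notI by simp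
      show "insert {y, y'} I \<subseteq> touching Ed ?W" using It t by auto
      show "\<forall>e\<in>insert {y, y'} I. e \<subseteq> ?W \<union> {x', y'}" using xy by (auto simp: I_def)
      show "(x', y') \<in> (adj (insert {x', x} (insert {y, y'} I)))\<^sup>*"
        by (rule path) (auto intro: adj_rtrancl_mono[OF conn_I])
      show "\<forall>a b. {a, b} \<in> insert {y, y'} I \<longrightarrow> a \<in> {x'} \<longrightarrow> b \<in> {x'}"
      proof (intro allI impI)
        fix a b assume ab: "{a, b} \<in> insert {y, y'} I" "a \<in> {x'}"
        then have "{a, b} \<noteq> {y, y'}" using out(3) neq by (simp add: doubleton_eq_iff)
        then have "{x', b} \<in> I" using ab by simp
        then have False using I_in out(1) by blast
        then show "b \<in> {x'}" ..
      qed
    qed (use out in auto)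
  next
    case y
    show ?thesis unfolding W
    proof (intro exI conjI)
      show "{y, y'} \<in> touching Ed ?W - inn" using y t by auto
      show "{y, y'} \<notin> insert {x', x} I" using ne' notI by simp
      show "insert {x', x} I \<subseteq> touching Ed ?W" using It t by auto
      show "\<forall>e\<in>insert {x', x} I. e \<subseteq> ?W \<union> {x', y'}" using xy by (auto simp: I_def)
      show "(x', y') \<in> (adj (insert {y, y'} (insert {x', x} I)))\<^sup>*"
        by (rule path) (auto intro: adj_rtrancl_mono[OF conn_I])
      show "\<forall>a b. {a, b} \<in> insert {x', x} I \<longrightarrow> a \<in> insert x' ?W \<longrightarrow> b \<in> insert x' ?W"
      proof (intro allI impI)
        fix a b assume "{a, b} \<in> insert {x', x} I"
        then consider "{a, b} = {x', x}" | "{a, b} \<in> I" by blast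
        then show "b \<in> insert x' ?W"
          by cases (use xy(1) in \<open>simp only: doubleton_eq_iff, blast\<close>, use I_in in blast)
      qed
      show "insert x' ?W \<subseteq> insert x' ?W" by (rule order_refl)
      show "y' \<notin> insert x' ?W" using out by blast
    qed auto
  next
    case inner
    obtain a i b l where ab: "x = (a, i)" "x' = (b, l)" by (cases x, cases x')
    obtain c j d k' where cd: "y = (c, j)" "y' = (d, k')" by (cases y, cases y')
    have 1: "a = b \<and> a \<in> U r \<and> l = (if i = m then m - 1 else m + 2)"
      using inner_leaves_block[of b l a i r m] inner(1) xy(1) out(1) unfolding ab by blast
    have "{y', y} \<in> inn" using inner(2) by (simp add: insert_commute)
    then have 2: "c = d \<and> c \<in> U r \<and> k' = (if j = m then m - 1 else m + 2)"
      using inner_leaves_block[of d k' c j r m] xy(2) out(2) unfolding cd by blast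
    \<comment> \<open>A point of the block determines the rung leaving it there, so equal entry
      points would give \<open>x' = y'\<close>.\<close>
    have "x \<noteq> y" using 1 2 out(3) unfolding ab cd by auto
    moreover have "x \<in> U r \<times> {m, m + 1}" "y \<in> U r \<times> {m, m + 1}" using 1 2 xy ab cd by auto
    ultimately have "bridged ?W x y" by (intro bridged_block)
    then obtain \<eta> f C where *: "f \<in> Ed - inn" "f \<subseteq> ?W" "f \<notin> \<eta>" "\<eta> \<subseteq> Ed" "\<forall>e\<in>\<eta>. e \<subseteq> ?W"
        "(x, y) \<in> (adj (insert f \<eta>))\<^sup>*" "x \<in> C" "y \<notin> C" "C \<subseteq> ?W"
        "\<forall>a b. {a, b} \<in> \<eta> \<longrightarrow> a \<in> C \<longrightarrow> b \<in> C"
      unfolding bridged_def by (elim exE conjE) (rule that; assumption)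
    have fI: "f \<in> I" "\<eta> \<subseteq> I" using * by (auto simp: I_def)
    let ?\<eta> = "insert {x', x} (insert {y, y'} \<eta>)"
    show ?thesis unfolding W
    proof (intro exI conjI)
      show "f \<in> touching Ed ?W - inn" using fI It * by auto
      show "f \<notin> ?\<eta>" using * out by auto
      show "?\<eta> \<subseteq> touching Ed ?W" using fI It t by auto
      show "\<forall>e\<in>?\<eta>. e \<subseteq> ?W \<union> {x', y'}" using xy * by auto
      show "(x', y') \<in> (adj (insert f ?\<eta>))\<^sup>*"
        by (rule path) (auto intro: adj_rtrancl_mono[OF *(6)])
      show "insert x' C \<subseteq> insert x' ?W" using * by auto
      show "y' \<notin> insert x' C" using out * by blast
      show "\<forall>a b. {a, b} \<in> ?\<eta> \<longrightarrow> a \<in> insert x' C \<longrightarrow> b \<in> insert x' C"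
      proof (intro allI impI)
        fix s t assume st: "{s, t} \<in> ?\<eta>" "s \<in> insert x' C"
        then consider "{s, t} = {x', x}" | "{s, t} = {y, y'}" | "{s, t} \<in> \<eta>" by auto
        then show "t \<in> insert x' C"
        proof cases
          case 1
          then show ?thesis using *(7) by (auto simp: doubleton_eq_iff)
        next
          case 2
          then have "s = y \<or> s = y'" by (auto simp: doubleton_eq_iff)
          moreover have "y \<noteq> x'" "y' \<notin> C" using *(9) out xy(2) by blast+
          ultimately have False using st(2) *(8) out(3) by (elim disjE insertE) auto
          then show ?thesis ..
        next
          case 3
          then have "s \<noteq> x'" using *(5) out(1) by blast
          then show ?thesis using st(2) 3 *(10) by blast
        qed
      qed
    qed auto
  qed
qed

section \<open>The ladder as a blocked graph\<close>

lemma ladder_rtrancl_vertical: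
  assumes "x \<in> V"
  shows "((x, 0), (x, n)) \<in> (adj Ed)\<^sup>*"
proof -
  have step: "((x, k), (x, k + 1)) \<in> (adj Ed)\<^sup>*" for k
    using assms vertical[of x k] by (intro adj_edge) auto
  show ?thesis
  proof (induction n rule: int_induct[of _ 0])
    case (step1 i)
    then show ?case using step[of i] by (meson rtrancl_trans)
  next
    case (step2 i)
    then show ?case using adj_rtrancl_sym[OF step[of "i - 1"]] by (auto intro: rtrancl_trans)
  qed simp
qed

lemma ladder_degree:
  assumes "x \<in> V"
  shows "finite {e \<in> Ed. (x, n) \<in> e} \<and> card {e \<in> Ed. (x, n) \<in> e} \<le> D + 2"
proof -
  let ?h = "(\<lambda>e. e \<times> {n}) ` {e \<in> E. x \<in> e}"
  let ?v = "{{(x, n), (x, n + 1)}, {(x, n - 1), (x, n)}}"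
  have sub: "{e \<in> Ed. (x, n) \<in> e} \<subseteq> ?h \<union> ?v"
  proof
    fix e assume e: "e \<in> {e \<in> Ed. (x, n) \<in> e}"
    then consider a b k where "e = {(a, k), (b, k)}" "{a, b} \<in> E" | a k where "e = {(a, k), (a, k + 1)}"
      unfolding ladder_edges_def by blast
    then show "e \<in> ?h \<union> ?v"
    proof cases
      case 1
      then have "e = {a, b} \<times> {n}" "x \<in> {a, b}" using e by auto
      then show ?thesis using 1 by blast
    next
      case 2
      then have "e = {(x, n), (x, n + 1)} \<or> e = {(x, n - 1), (x, n)}" using e by auto
      then show ?thesis by blast
    qed
  qed
  have fin: "finite (?h \<union> ?v)" using deg[OF assms] by auto
  have "card (?h \<union> ?v) \<le> card ?h + card ?v" by (rule card_Un_le)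
  also have "card ?h \<le> D" using deg[OF assms] card_image_le[of "{e \<in> E. x \<in> e}" "\<lambda>e. e \<times> {n}"] by linarith
  also have "card ?v \<le> 2" by (simp add: card_insert_if)
  finally have "card (?h \<union> ?v) \<le> D + 2" by simp
  with card_mono[OF fin sub] have "card {e \<in> Ed. (x, n) \<in> e} \<le> D + 2" by (rule order_trans)
  with finite_subset[OF sub fin] show ?thesis by (rule conjI)
qed

lemma inn_sub: "inn \<subseteq> Ed"
  unfolding inner_edges_def ladder_edges_def using F_sub U_sub by blast

lemma in_blk: "x \<in> blk x"
proof (cases x)
  case (Pair u n)
  show ?thesis
  proof (cases "\<exists>r. u \<in> N r")
    case True
    then obtain r where u: "u \<in> N r" by blast
    have "n = 2 * (n div 2) \<or> n = 2 * (n div 2) + 1" by presburger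
    then show ?thesis unfolding Pair blk_N[OF u] using u by blast
  next
    case False
    then have "blk (u, n) = {(u, n)}" by (intro blk_other) blast
    then show ?thesis by (simp add: Pair)
  qed
qed

lemma blk_cases:
  obtains (N) r n where "fst x \<in> N r" "snd x div 2 = n" "blk x = N r \<times> {2 * n, 2 * n + 1}"
    | (single) "blk x = {x}"
  using blk_N[of "fst x" _ "snd x"] blk_other[of "fst x" "snd x"] by (metis prod.collapse)

text \<open>Each vertex has two rungs besides its horizontal edges, hence \<open>D + 2\<close>; a
  block has two layers of at most \<open>Suc k\<close> vertices, hence
  \<open>2 * Suc k\<close>.\<close>

sublocale blocked_graph X Ed inn blk "(v, 0)" "D + 2" "2 * Suc k"
proof
  fix e assume "e \<in> Ed"
  then consider a b n where "e = {(a, n), (b, n)}" "{a, b} \<in> E" | a n where "e = {(a, n), (a, n + 1)}" "a \<in> V"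
    unfolding ladder_edges_def by blast
  then show "\<exists>a\<in>X. \<exists>b\<in>X. a \<noteq> b \<and> e = {a, b}"
  proof cases
    case 1
    then show ?thesis using E_edge[of a b]
      by (intro bexI[of _ "(a, n)"] bexI[of _ "(b, n)"]) (auto simp: ladder_vertices_def)
  next
    case 2
    then show ?thesis
      by (intro bexI[of _ "(a, n)"] bexI[of _ "(a, n + 1)"]) (auto simp: ladder_vertices_def)
  qed
next
  show "(v, 0) \<in> X" using v by (simp add: ladder_vertices_def)
next
  fix x assume "x \<in> X"
  then obtain a n where x: "x = (a, n)" "a \<in> V" by (auto simp: ladder_vertices_def)
  have "((v, 0), (a, 0)) \<in> (adj Ed)\<^sup>*"
    using layer_rtrancl[OF E_rtrancl[OF v x(2)]] layer_sub by (rule adj_rtrancl_mono) simp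
  then show "((v, 0), x) \<in> (adj Ed)\<^sup>*"
    using ladder_rtrancl_vertical[OF x(2), of n] x by (auto intro: rtrancl_trans)
  show "finite {e \<in> Ed. x \<in> e} \<and> card {e \<in> Ed. x \<in> e} \<le> D + 2"
    using ladder_degree[OF x(2)] x by simp
  show "x \<in> blk x" by (rule in_blk)
  show "blk x \<subseteq> X"
    using \<open>x \<in> X\<close> N_sub by (cases x rule: blk_cases) (auto simp: ladder_vertices_def)
  show "finite (blk x)" using finN by (cases x rule: blk_cases) auto
  show "card (blk x) \<le> 2 * Suc k"
  proof (cases x rule: blk_cases)
    case (N r n)
    then show ?thesis using cardN[of r] by (simp add: card_cartesian_product)
  qed simp
  fix y assume y: "y \<in> blk x"
  show "blk y = blk x"
  proof (cases x rule: blk_cases)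
    case (N r n)
    obtain b l where b: "y = (b, l)" "b \<in> N r" "l = 2 * n \<or> l = 2 * n + 1" using y N by (cases y) auto
    then have "l div 2 = n" by auto
    then show ?thesis using blk_N[OF b(2), of l] b N by simp
  next
    case single
    then show ?thesis using y by simp
  qed
  show "(x, y) \<in> (adj {e \<in> Ed. e \<subseteq> blk x})\<^sup>*"
  proof (cases x rule: blk_cases)
    case (N r n)
    have "(x, y) \<in> (adj {e \<in> Ed. e \<subseteq> N r \<times> {2 * n, 2 * n + 1}})\<^sup>*"
      using y in_blk[of x] unfolding N by (intro W_connected) auto
    then show ?thesis by (simp only: N)
  next
    case single
    then show ?thesis using y by simp
  qed
next
  show "inn \<subseteq> Ed" by (rule inn_sub)
qed (rule rewire_ladder)

text \<open>If \<open>v\<close> lies in \<open>U r\<close>, the strip is exhausted by slabs, and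
  only the rungs just above the top and just below the bottom leave a slab, at most
  \<open>2 * k\<close> in all. Otherwise the origin has no inner edge.\<close>

lemma theta_only_inner: "0 < q \<Longrightarrow> q < 1 \<Longrightarrow> theta q 0 = 0"
proof (cases "\<exists>r. v \<in> U r")
  case True
  assume q: "0 < q" "q < 1"
  from True obtain r where r: "v \<in> U r" by auto
  let ?N = "\<lambda>n. U r \<times> {- int n..int n}"
  have edge_r: "\<exists>a b l m. e = {(a, l), (b, m)} \<and> a \<in> U r \<and> b \<in> U r \<and> (l = m \<or> a = b \<and> m = l + 1)"
    if "e \<in> inn" "e \<inter> ?N n \<noteq> {}" for e n
    using that(1)
  proof (cases rule: inner_cases)
    case (hor s a b l)
    then have "s = r" using that(2) U_disjoint[of a s r] U_disjoint[of b s r] by auto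
    then show ?thesis using hor by blast
  next
    case (ver s a l)
    then have "s = r" using that(2) U_disjoint[of a s r] by auto
    then show ?thesis using ver by blast
  qed
  show ?thesis
  proof (rule theta_zero[OF q, of ?N "2 * k"])
    fix n
    show "(v, 0) \<in> ?N n" using r by auto
    show "finite (?N n)" using finU by auto
    show "?N n \<subseteq> X" using U_sub by (auto simp: ladder_vertices_def)
    show "?N n \<subseteq> ?N (Suc n)" by auto
    let ?g = "\<lambda>l a. {(a, l), (a, l + 1)} :: ('a \<times> int) set"
    have sub: "{e \<in> inn. e \<inter> ?N n \<noteq> {} \<and> \<not> e \<subseteq> ?N n} \<subseteq> ?g (int n) ` U r \<union> ?g (- int n - 1) ` U r"
    proof
      fix e assume e: "e \<in> {e \<in> inn. e \<inter> ?N n \<noteq> {} \<and> \<not> e \<subseteq> ?N n}"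
      then obtain a b l m where *: "e = {(a, l), (b, m)}" "a \<in> U r" "b \<in> U r" "l = m \<or> a = b \<and> m = l + 1"
        using edge_r[of e n] by auto
      then have "a = b" "m = l + 1" "l = int n \<or> l = - int n - 1" using e by auto
      then show "e \<in> ?g (int n) ` U r \<union> ?g (- int n - 1) ` U r" using * by auto
    qed
    have "card (?g (int n) ` U r \<union> ?g (- int n - 1) ` U r) \<le> card (?g (int n) ` U r) + card (?g (- int n - 1) ` U r)"
      by (rule card_Un_le)
    also have "\<dots> \<le> card (U r) + card (U r)" using finU by (intro add_mono card_image_le) auto
    also have "\<dots> \<le> 2 * k" using cardU[of r] by simp
    finally show "card {e \<in> inn. e \<inter> ?N n \<noteq> {} \<and> \<not> e \<subseteq> ?N n} \<le> 2 * k"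
      using card_mono[OF _ sub] finU by fastforce
  next
    fix n e assume "e \<in> inn" "e \<inter> ?N n \<noteq> {}"
    with edge_r[OF this] show "e \<subseteq> ?N (Suc n)" by auto
  qed
next
  case False
  assume q: "0 < q" "q < 1"
  have none: "e \<inter> {(v, 0)} = {}" if "e \<in> inn" for e
    using that by (cases rule: inner_cases) (use False in auto)
  then have "{e \<in> inn. e \<inter> {(v, 0)} \<noteq> {} \<and> \<not> e \<subseteq> {(v, 0)}} = {}" by blast
  then have "card {e \<in> inn. e \<inter> {(v, 0)} \<noteq> {} \<and> \<not> e \<subseteq> {(v, 0)}} \<le> 0"
    by (simp only: card.empty)
  \<comment> \<open>With cut bound 0 the decay factor \<open>1 - c ^ 0\<close> is 0, so a constant
    sequence of sets suffices.\<close>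
  then show ?thesis
    by (rule theta_zero[OF q, of "\<lambda>_. {(v, 0)}" 0, rotated 5])
      (use none v in \<open>auto simp: ladder_vertices_def\<close>)
qed

lemma perc_prob_eq_theta: "perc_prob V E U F (v, 0) q p = theta q p"
proof -
  have "cluster V E \<omega> (v, 0) = open_cluster {e \<in> Ed. \<omega> e}" for \<omega>
  proof (intro set_eqI iffI)
    fix y assume "y \<in> cluster V E \<omega> (v, 0)"
    then show "y \<in> open_cluster {e \<in> Ed. \<omega> e}"
      unfolding cluster_def open_cluster_def by (blast dest: graph_path_imp_rtrancl)
  next
    fix y assume "y \<in> open_cluster {e \<in> Ed. \<omega> e}"
    then have "\<exists>xs. graph_path X {e \<in> Ed. \<omega> e} (v, 0) xs y"
      unfolding open_cluster_def mem_Collect_eq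
    proof (rule rtrancl_imp_graph_path)
      show "(v, 0) \<in> X" by (rule o0)
      fix e assume "e \<in> {e \<in> Ed. \<omega> e}"
      then show "e \<subseteq> X" using edge[of e] by auto
    qed
    then show "y \<in> cluster V E \<omega> (v, 0)" by (simp add: cluster_def)
  qed
  moreover have "perc_measure V E U F q p = bond_measure q p"
    by (simp add: perc_measure_def bond_measure_def weight_def)
  ultimately show ?thesis by (simp add: perc_prob_def theta_def)
qed

section \<open>Monotonicity and continuity of the critical curve\<close>

abbreviation pc :: "real \<Rightarrow> real" where "pc \<equiv> critical_curve V E U F v"

lemma theta_le_pc: "0 \<le> p \<Longrightarrow> p \<le> 1 \<Longrightarrow> theta q p = 0 \<Longrightarrow> p \<le> pc q"
  unfolding critical_curve_def perc_prob_eq_theta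
  by (intro cSup_upper) (auto intro!: bdd_aboveI[of _ 1])

lemma pc_bounds:
  assumes "0 < q" "q < 1"
  shows "0 \<le> pc q" "pc q \<le> 1"
proof -
  show "0 \<le> pc q" using theta_le_pc[of 0 q] theta_only_inner[OF assms] by simp
  show "pc q \<le> 1" unfolding critical_curve_def perc_prob_eq_theta
    using theta_only_inner[OF assms] by (intro cSup_least) (auto intro!: exI[of _ 0])
qed

lemma theta_below_pc:
  assumes q: "0 < q" "q < 1" and p: "0 \<le> p" "p < pc q"
  shows "theta q p = 0"
proof -
  have "0 \<in> {p \<in> {0..1}. theta q p = 0}" using theta_only_inner[OF q] by simp
  then obtain p' where "p' \<in> {0..1}" "theta q p' = 0" "p < p'"
    using p less_cSupE[of p "{p \<in> {0..1}. theta q p = 0}"]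
    unfolding critical_curve_def perc_prob_eq_theta by blast
  then show ?thesis using theta_mono[of q q p p'] theta_nonneg[of q p] q p by auto
qed

lemma pc_antimono:
  assumes "0 < q1" "q1 \<le> q2" "q2 < 1"
  shows "pc q2 \<le> pc q1"
\<comment> \<open>The lower end -1 keeps the interval nonempty when \<open>pc q2 = 0\<close>;
  negative \<open>p\<close> are covered by \<open>0 \<le> pc q1\<close>.\<close>
proof (rule dense_le_bounded[of "-1"])
  show "-1 < pc q2" using pc_bounds[of q2] assms by linarith
  fix p assume p: "-1 < p" "p < pc q2"
  show "p \<le> pc q1"
  proof (cases "p \<ge> 0")
    case True
    have "p \<le> 1" using p pc_bounds[of q2] assms by linarith
    moreover have "theta q2 p = 0" using True p assms by (intro theta_below_pc) auto
    ultimately have "theta q1 p = 0"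
      using theta_mono[of q1 q2 p p] theta_nonneg[of q1 p] True assms by auto
    then show ?thesis using True \<open>p \<le> 1\<close> by (intro theta_le_pc)
  next
    case False
    then show ?thesis using pc_bounds[of q1] assms by linarith
  qed
qed

definition slope :: "real \<Rightarrow> real" where
  "slope c = real (2 * (2 * Suc k * (D + 2))) / c ^ (2 * Suc k * (D + 2))"

text \<open>If \<open>pc q1\<close> exceeded \<open>pc q2\<close> by more than \<open>3 * c\<close>,
  then \<open>theta\<close> would vanish at \<open>(q1, pc q2 + 2 * c)\<close> and, by comparison,
  at \<open>(q2, pc q2 + c)\<close>, above the critical value. The margins of \<open>c\<close> keep
  both parameters in \<open>[c, 1 - c]\<close> even if \<open>pc q2 = 0\<close> or
  \<open>pc q1 = 1\<close>.\<close>

lemma pc_modulus: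
  assumes c: "0 < c" and q: "c \<le> q1" "q1 \<le> q2" "q2 \<le> 1 - c" and d: "slope c * (q2 - q1) \<le> c"
  shows "pc q1 \<le> pc q2 + 3 * c"
proof (rule ccontr)
  assume "\<not> ?thesis"
  then have gt: "pc q2 + 3 * c < pc q1" by simp
  let ?p1 = "pc q2 + c" and ?p2 = "pc q2 + 2 * c"
  have b: "0 \<le> pc q2" "pc q1 \<le> 1" using pc_bounds[of q2] pc_bounds[of q1] c q by auto
  have "theta q1 ?p2 = 0" using gt b c q by (intro theta_below_pc) auto
  moreover have "c ^ card {e \<in> Ed. e \<subseteq> K} * theta q2 ?p1 \<le> theta q1 ?p2"
    using b gt c q d unfolding slope_def by (intro theta_compare) auto
  ultimately have "theta q2 ?p1 = 0"
    using theta_nonneg[of q2 ?p1] zero_less_power[OF c, of "card {e \<in> Ed. e \<subseteq> K}"]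
    by (auto simp: mult_le_0_iff)
  then have "?p1 \<le> pc q2" using b gt c by (intro theta_le_pc) auto
  then show False using c by simp
qed

lemma continuous_pc: "continuous_on {0<..<1} pc"
  unfolding continuous_on_iff
proof (intro ballI allI impI)
  fix q0 e :: real assume q0: "q0 \<in> {0<..<1}" and e: "0 < e"
  \<comment> \<open>\<open>e / 4\<close> makes \<open>3 * c < e\<close>; the other two bounds, with
    \<open>\<delta> \<le> c\<close>, keep every \<open>q\<close> within \<open>\<delta>\<close> of
    \<open>q0\<close> in \<open>[c, 1 - c]\<close>.\<close>
  define c where "c = min (e / 4) (min (q0 / 2) ((1 - q0) / 2))"
  have c: "0 < c" "c \<le> e / 4" "c \<le> q0 / 2" "c \<le> (1 - q0) / 2" using q0 e by (auto simp: c_def min_def)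
  have s: "0 \<le> slope c" using c by (auto simp: slope_def)
  define \<delta> where "\<delta> = min c (c / (slope c + 1))"
  have \<delta>: "0 < \<delta>" "\<delta> \<le> c" using c s by (auto simp: \<delta>_def)
  have "(slope c + 1) * \<delta> \<le> (slope c + 1) * (c / (slope c + 1))"
    unfolding \<delta>_def using s by (intro mult_left_mono) auto
  then have s_\<delta>: "(slope c + 1) * \<delta> \<le> c" using s by simp
  have close: "\<bar>pc q1 - pc q2\<bar> < e" if "c \<le> q1" "q1 \<le> q2" "q2 \<le> 1 - c" "q2 - q1 < \<delta>" for q1 q2
  proof -
    have "slope c * (q2 - q1) \<le> (slope c + 1) * \<delta>" using that s by (intro mult_mono) auto
    then have "pc q1 \<le> pc q2 + 3 * c" using that c s_\<delta> by (intro pc_modulus) auto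
    moreover have "pc q2 \<le> pc q1" using that c by (intro pc_antimono) auto
    ultimately show ?thesis using c e by auto
  qed
  show "\<exists>d>0. \<forall>q\<in>{0<..<1}. dist q q0 < d \<longrightarrow> dist (pc q) (pc q0) < e"
  proof (intro exI[of _ \<delta>] conjI ballI impI)
    fix q assume q: "dist q q0 < \<delta>"
    show "dist (pc q) (pc q0) < e"
    proof (cases "q \<le> q0")
      case True
      then show ?thesis using close[of q q0] q c \<delta> by (auto simp: dist_real_def)
    next
      case False
      then show ?thesis using close[of q0 q] q c \<delta> by (auto simp: dist_real_def abs_minus_commute)
    qed
  qed (rule \<delta>(1))
qed

end

theorem theorem1:
  fixes V :: "'a set" and E :: "'a set set"
    and U :: "nat \<Rightarrow> 'a set" and F :: "nat \<Rightarrow> 'a set set" and v :: 'a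
  assumes "simple_graph V E" and "infinite V" and "connected_graph V E" and "bounded_degree V E"
    and "\<And>r. subgraph_of (U r) (F r) V E"
    and "\<And>r. finite (U r)"
    and "\<And>r. connected_graph (U r) (F r)"
    and "\<And>i j. i \<noteq> j \<Longrightarrow> graph_setdist V E (U i) (U j) \<ge> 3"
    and "(SUP r. enat (card (U r))) < \<infinity>"
    and "v \<in> V"
  shows "continuous_on {0<..<1} (\<lambda>q. critical_curve V E U F v q)"
proof -
  obtain D where D: "\<And>x. x \<in> V \<Longrightarrow> finite {e\<in>E. x \<in> e} \<and> card {e\<in>E. x \<in> e} \<le> D"
    using assms(4) unfolding bounded_degree_def by blast
  obtain k where k: "(SUP r. enat (card (U r))) = enat k"
    using assms(9) by (cases "SUP r. enat (card (U r))") auto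
  have "card (U r) \<le> k" for r
  proof -
    have "enat (card (U r)) \<le> (SUP r. enat (card (U r)))" by (rule SUP_upper) simp
    then show ?thesis by (simp add: k)
  qed
  then interpret ladder_perc V E U F v D k
    using assms D by unfold_locales auto
  show ?thesis by (rule continuous_pc)
qed

end
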